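(* Let $k$ be a field of characteristic $\neq 2$ with separable closure $\bar k$. Let $n>1$, and let $G$ be a finite group with a fixed (not necessarily minimal) generating set $\{\sigma_1,\dots,\sigma_\kappa\}$ such that $\sigma_1$ has order $2^{n-1}$, the subgroup $H=\langle\sigma_2,\dots,\sigma_\kappa\rangle$ is normal in $G$, and $G/H$ is isomorphic to the cyclic group $C_{2^{n-1}}$, i.e. $\sigma_1^i\notin H$ for $1\leq i<2^{n-1}$. Let $\zeta_{2^{n-1}}\in\bar k$ be a primitive $2^{n-1}$th root of unity and let $\varphi:G/H\to\bar k^\times$ be the homomorphism induced by the isomorphism $G/H\cong\langle\zeta_{2^{n-1}}\rangle$, $\sigma_1H\mapsto\zeta_{2^{n-1}}$, and the inclusion $\langle\zeta_{2^{n-1}}\rangle\hookrightarrow\bar k^\times$; write $\varphi$ also for its composition with $G\to G/H$. Let $G\hookrightarrow O(q)$ be a (faithful) orthogonal representation, where $q$ is a regular quadratic form over $k$, and let $$1\longrightarrow\mu_2\longrightarrow\widetilde G\longrightarrow G\longrightarrow 1$$ be the restriction to $G$ of the extension $$1\longrightarrow\mu_2\longrightarrow\mathrm{Pin}(\bar q)\xrightarrow{\ r\ } O(\bar q)\longrightarrow 1,$$ i.e. $\widetilde G$ is the preimage of $G$ in $\mathrm{Pin}(\bar q)$. Then there exists a subgroup $\bar G$ of $C^\times(\bar q)$ such that: (1) The diagram $$\begin{array}{ccccccccc} 1&\to&\mu_2&\to&\bar G&\xrightarrow{\ r'\ }&G&\to&1\\ &&\downarrow{\scriptstyle N}&&\downarrow{\scriptstyle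 N}&&\downarrow{\scriptstyle\varphi}&&\\ 1&\to&1&\to&\bar k^\times&=&\bar k^\times&\to&1 \end{array}$$ is commutative with exact rows, where $N$ is the norm and $r'$ is the restriction of $r:C^\times(\bar q)\to O(\bar q)$ to $\bar G$. (2) Either $\bar G=\widetilde G^{(2^n,\sigma_1)}$ or $\widetilde G=\bar G^{(2^n,\sigma_1)}$.
   Context: Clifford algebra notation. Let $(V,q)$ be a finite-dimensional regular quadratic space over a field of characteristic $\neq2$. $O(q)$ is its orthogonal group. $C(q)=C_0(q)\oplus C_1(q)$ is the Clifford algebra with its $\mathbb Z/2$-grading; for a homogeneous element $x\in C_i(q)$ write $\partial x=i$. $C^\times(q)$ is the Clifford group: the group of invertible homogeneous elements $x\in C(q)$ with $xVx^{-1}=V$. The map $r:C^\times(q)\to O(q)$, $x\mapsto r_x$, is $r_x(u)=(-1)^{\partial x}xux^{-1}$ for $u\in V$; it is surjective with kernel the nonzero scalars. $\iota$ is the principal involution of $C(q)$, which preserves scalars, sums and vectors and reverses products, and $N(x)=x\iota(x)$ is the norm, a homomorphism from $C^\times(q)$ to the nonzero scalars. $\mathrm{Pin}(q)=\ker N$. $\bar q$ denotes the extension of $q$ to $\bar k$. $\mu_2=\{\pm1\}$. Notation $G_2=G_1^{(2^n,\sigma_1)}$. Let $G$, $\sigma_1,\dots,\sigma_\kappa$, $n$ be as in the claim, and let $1\to\mu_2\to G_1\to G\to1$ and $1\to\mu_2\to G_2\to G\to1$ be two group extensions. One writes $G_2=G_1^{(2^n,\sigma_1)}$ if, for suitable preimages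 $\widetilde\sigma_i\in G_1$ and $\bar\sigma_i\in G_2$ of $\sigma_i$ ($i=1,\dots,\kappa$): (i) $\widetilde\sigma_1$ has order $2^{n-1}$; (ii) $\bar\sigma_1^{2^{n-1}}\in\mu_2$ and $\bar\sigma_1^{2^{n-1}}\neq1$ (so $\bar\sigma_1^{2^{n-1}}=-1$); (iii) all other relations between the generators of $G_1$ and $G_2$ are identical, i.e. for $i=2,\dots,\kappa$ and integers $l,\alpha_i,\beta_j$: $\widetilde\sigma_i^{\alpha_i}=(-1)^l\prod_{j\neq1}\widetilde\sigma_j^{\beta_j}\iff\bar\sigma_i^{\alpha_i}=(-1)^l\prod_{j\neq1}\bar\sigma_j^{\beta_j}$; and for $i,j=1,\dots,\kappa$ and integers $l,\varepsilon_s$: $[\widetilde\sigma_i,\widetilde\sigma_j]=(-1)^l\prod_{s\neq1}\widetilde\sigma_s^{\varepsilon_s}\iff[\bar\sigma_i,\bar\sigma_j]=(-1)^l\prod_{s\neq1}\bar\sigma_s^{\varepsilon_s}$, where products are taken in order of increasing index and $[a,b]=a^{-1}b^{-1}ab$. *)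

theory Defs
  imports
    "HOL-Analysis.Cartesian_Space"
    "HOL-Library.Poly_Mapping"
    "HOL-Algebra.Algebra"
    "HOL-Algebra.Algebraic_Closure_Type"
begin

section \<open>Separable closures and roots of unity\<close>

text \<open>\<open>h\<close> embeds the field \<open>'k\<close> into the field \<open>'K\<close>; every element of \<open>'K\<close> is algebraic and
  separable over \<open>'k\<close>, and \<open>'K\<close> is separably closed.  An irreducible polynomial with root \<open>x\<close> is
  the minimal polynomial of \<open>x\<close> up to a unit.\<close>

definition separable_closure :: "('k::field \<Rightarrow> 'K::field) \<Rightarrow> bool" where
  "separable_closure h \<longleftrightarrow>
     h 1 = 1 \<and> (\<forall>a b. h (a + b) = h a + h b) \<and> (\<forall>a b. h (a * b) = h a * h b) \<and>
     (\<forall>x. \<exists>p :: 'k poly. Factorial_Ring.irreducible p \<and> Rings.coprime p (Polynomial.pderiv p) \<and>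
            Polynomial.poly (Polynomial.map_poly h p) x = 0) \<and>
     (\<forall>p :: 'K poly. Polynomial.degree p > 0 \<and> Rings.coprime p (Polynomial.pderiv p) \<longrightarrow>
            (\<exists>x. Polynomial.poly p x = 0))"

definition primitive_root_of_unity :: "nat \<Rightarrow> 'a::field \<Rightarrow> bool" where
  "primitive_root_of_unity m z \<longleftrightarrow> z ^ m = 1 \<and> (\<forall>i\<in>{1..<m}. z ^ i \<noteq> 1)"

abbreviation field_units :: "'a::field monoid" where
  "field_units \<equiv> mult_of ring_of_type_algebra"


section \<open>Quadratic forms and their orthogonal groups\<close>

text \<open>A quadratic form on \<open>'a ^ 'n\<close> is given by a coefficient matrix (not necessarily symmetric).
  Extending scalars along a field embedding \<open>h\<close> means applying \<open>map_matrix h\<close> to it.\<close>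

definition qform :: "'a::field ^ 'n::finite ^ 'n \<Rightarrow> 'a ^ 'n \<Rightarrow> 'a" where
  "qform Q v = (\<Sum>i\<in>UNIV. \<Sum>j\<in>UNIV. Q $ i $ j * v $ i * v $ j)"

definition polar :: "('a::field ^ 'n::finite \<Rightarrow> 'a) \<Rightarrow> 'a ^ 'n \<Rightarrow> 'a ^ 'n \<Rightarrow> 'a" where
  "polar q v w = q (v + w) - q v - q w"

definition regular_form :: "('a::field ^ 'n::finite \<Rightarrow> 'a) \<Rightarrow> bool" where
  "regular_form q \<longleftrightarrow> (\<forall>v. (\<forall>w. polar q v w = 0) \<longrightarrow> v = 0)"

definition orthogonal_grp ::
    "('a::field ^ 'n::finite \<Rightarrow> 'a) \<Rightarrow> ('a ^ 'n ^ 'n) monoid" where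
  "orthogonal_grp q =
     \<lparr>carrier = {A. invertible A \<and> (\<forall>v. q (A *v v) = q v)}, monoid.mult = (**), one = mat 1\<rparr>"


section \<open>The Clifford algebra\<close>

text \<open>The tensor algebra of \<open>'a ^ 'n\<close> is the free associative algebra on the standard basis,
  that is, the algebra \<open>'n word \<Rightarrow>\<^sub>0 'a\<close> of the free monoid on \<open>'n\<close>.  The free monoid is written
  additively because the convolution product on \<open>\<Rightarrow>\<^sub>0\<close> is.\<close>

datatype 'n word = Word (letters: "'n list")

instantiation word :: (type) monoid_add
begin
definition zero_word :: "'a word" where "0 = Word []"
definition plus_word :: "'a word \<Rightarrow> 'a word \<Rightarrow> 'a word" where
  "u + w = Word (letters u @ letters w)"
instance
  by standard (auto simp: zero_word_def plus_word_def)
end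

type_synonym ('a, 'n) tensor = "'n word \<Rightarrow>\<^sub>0 'a"
type_synonym ('a, 'n) cliff = "('a, 'n) tensor set"

abbreviation tensor_ring :: "('a::field, 'n) tensor ring" where
  "tensor_ring \<equiv> ring_of_type_algebra"

definition tensor_scalar :: "'a::field \<Rightarrow> ('a, 'n) tensor" where
  "tensor_scalar c = Poly_Mapping.single 0 c"

definition tensor_vec :: "'a::field ^ 'n::finite \<Rightarrow> ('a, 'n) tensor" where
  "tensor_vec v = (\<Sum>i\<in>UNIV. Poly_Mapping.single (Word [i]) (v $ i))"

definition clifford_ideal ::
    "('a::field ^ 'n::finite \<Rightarrow> 'a) \<Rightarrow> ('a, 'n) tensor set" where
  "clifford_ideal q = genideal tensor_ring
     (range (\<lambda>v. tensor_vec v * tensor_vec v - tensor_scalar (q v)))"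

definition clifford_algebra ::
    "('a::field ^ 'n::finite \<Rightarrow> 'a) \<Rightarrow> ('a, 'n) cliff ring" where
  "clifford_algebra q = tensor_ring Quot clifford_ideal q"

definition cl_class ::
    "('a::field ^ 'n::finite \<Rightarrow> 'a) \<Rightarrow> ('a, 'n) tensor \<Rightarrow> ('a, 'n) cliff" where
  "cl_class q p = clifford_ideal q +>\<^bsub>tensor_ring\<^esub> p"

definition cl_scalar ::
    "('a::field ^ 'n::finite \<Rightarrow> 'a) \<Rightarrow> 'a \<Rightarrow> ('a, 'n) cliff" where
  "cl_scalar q c = cl_class q (tensor_scalar c)"

definition cl_vec ::
    "('a::field ^ 'n::finite \<Rightarrow> 'a) \<Rightarrow> 'a ^ 'n \<Rightarrow> ('a, 'n) cliff" where
  "cl_vec q v = cl_class q (tensor_vec v)"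

text \<open>The homogeneous components \<open>C\<^sub>0\<close> and \<open>C\<^sub>1\<close>.\<close>

definition cl_part ::
    "('a::field ^ 'n::finite \<Rightarrow> 'a) \<Rightarrow> nat \<Rightarrow> ('a, 'n) cliff set" where
  "cl_part q i = cl_class q ` {p. \<forall>w\<in>Poly_Mapping.keys p. length (letters w) mod 2 = i}"

text \<open>The degree is only meaningful on nonzero homogeneous elements.\<close>

definition cl_deg :: "('a::field ^ 'n::finite \<Rightarrow> 'a) \<Rightarrow> ('a, 'n) cliff \<Rightarrow> nat" where
  "cl_deg q x = (if x \<in> cl_part q 0 then 0 else 1)"

text \<open>Reversing words is an anti-automorphism of the tensor algebra that fixes the generators of the
  Clifford ideal, hence maps the coset of \<open>p\<close> onto the coset of the reversal of \<open>p\<close>.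
  The induced map is the principal involution.\<close>

definition tensor_rev :: "('a::field, 'n) tensor \<Rightarrow> ('a, 'n) tensor" where
  "tensor_rev = Poly_Mapping.map_key (\<lambda>w. Word (rev (letters w)))"

definition cl_involution :: "('a::field, 'n) cliff \<Rightarrow> ('a, 'n) cliff" where
  "cl_involution x = tensor_rev ` x"

definition cl_norm ::
    "('a::field ^ 'n::finite \<Rightarrow> 'a) \<Rightarrow> ('a, 'n) cliff \<Rightarrow> ('a, 'n) cliff" where
  "cl_norm q x = x \<otimes>\<^bsub>clifford_algebra q\<^esub> cl_involution x"


section \<open>The Clifford group and the Pin group\<close>

definition clifford_group ::
    "('a::field ^ 'n::finite \<Rightarrow> 'a) \<Rightarrow> ('a, 'n) cliff monoid" where
  "clifford_group q = (let C = clifford_algebra q; V = range (cl_vec q) in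
     \<lparr>carrier = {x \<in> Units C. x \<in> cl_part q 0 \<union> cl_part q 1 \<and>
                   (\<lambda>u. x \<otimes>\<^bsub>C\<^esub> u \<otimes>\<^bsub>C\<^esub> inv\<^bsub>C\<^esub> x) ` V = V},
      monoid.mult = monoid.mult C, one = \<one>\<^bsub>C\<^esub>\<rparr>)"

text \<open>The matrix of \<open>u \<mapsto> (-1)\<^bsup>\<partial>x\<^esup> x u x\<^sup>-\<^sup>1\<close> on \<open>'a ^ 'n\<close>; it is unique whenever \<open>cl_vec q\<close> is
  injective, in particular for regular \<open>q\<close> in characteristic other than 2.\<close>

definition cl_rot ::
    "('a::field ^ 'n::finite \<Rightarrow> 'a) \<Rightarrow> ('a, 'n) cliff \<Rightarrow> 'a ^ 'n ^ 'n" where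
  "cl_rot q x = (THE A. \<forall>u. cl_vec q (A *v u) =
     cl_scalar q ((-1) ^ cl_deg q x) \<otimes>\<^bsub>clifford_algebra q\<^esub> x
       \<otimes>\<^bsub>clifford_algebra q\<^esub> cl_vec q u \<otimes>\<^bsub>clifford_algebra q\<^esub> inv\<^bsub>clifford_algebra q\<^esub> x)"

definition Pin :: "('a::field ^ 'n::finite \<Rightarrow> 'a) \<Rightarrow> ('a, 'n) cliff set" where
  "Pin q = {x \<in> carrier (clifford_group q). cl_norm q x = \<one>\<^bsub>clifford_algebra q\<^esub>}"

text \<open>For a subgroup of the orthogonal group given as the injective image of \<open>G\<close> under \<open>\<rho>\<close>:
  its preimage in \<open>Pin q\<close>, and \<open>x \<mapsto> r\<^sub>x\<close> as a map to \<open>G\<close>.  The latter is meaningful only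
  for \<open>x\<close> with \<open>r\<^sub>x\<close> in the image of \<open>\<rho>\<close>.\<close>

definition pin_preimage ::
    "('a::field ^ 'n::finite \<Rightarrow> 'a) \<Rightarrow> 'g monoid \<Rightarrow> ('g \<Rightarrow> 'a ^ 'n ^ 'n) \<Rightarrow> ('a, 'n) cliff set" where
  "pin_preimage q G \<rho> = {x \<in> Pin q. cl_rot q x \<in> \<rho> ` carrier G}"

definition rot_to ::
    "('a::field ^ 'n::finite \<Rightarrow> 'a) \<Rightarrow> 'g monoid \<Rightarrow> ('g \<Rightarrow> 'a ^ 'n ^ 'n) \<Rightarrow> ('a, 'n) cliff \<Rightarrow> 'g" where
  "rot_to q G \<rho> x = inv_into (carrier G) \<rho> (cl_rot q x)"


section \<open>Extensions by \<open>\<mu>\<^sub>2\<close>\<close>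

text \<open>The library's \<open>short_exact_sequence\<close> forces all groups to have the same element type.\<close>

definition short_exact ::
    "'a monoid \<Rightarrow> 'b monoid \<Rightarrow> 'c monoid \<Rightarrow> ('a \<Rightarrow> 'b) \<Rightarrow> ('b \<Rightarrow> 'c) \<Rightarrow> bool" where
  "short_exact N E G i p \<longleftrightarrow> group N \<and> group E \<and> group G \<and>
     i \<in> mon N E \<and> p \<in> epi E G \<and> kernel E G p = i ` carrier N"

definition mu2 :: "int monoid" where
  "mu2 = \<lparr>carrier = {1, -1}, monoid.mult = (*), one = 1\<rparr>"

definition ordered_prod :: "'a monoid \<Rightarrow> 'a list \<Rightarrow> 'a" where
  "ordered_prod E xs = foldr (\<lambda>x y. x \<otimes>\<^bsub>E\<^esub> y) xs \<one>\<^bsub>E\<^esub>"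

definition commutator :: "'a monoid \<Rightarrow> 'a \<Rightarrow> 'a \<Rightarrow> 'a" where
  "commutator E a b = inv\<^bsub>E\<^esub> a \<otimes>\<^bsub>E\<^esub> inv\<^bsub>E\<^esub> b \<otimes>\<^bsub>E\<^esub> a \<otimes>\<^bsub>E\<^esub> b"

text \<open>\<open>(-1)\<^sup>l \<Prod>\<^sub>j\<^sub>\<noteq>\<^sub>1 s\<^sub>j\<^bsup>e j\<^esup>\<close> in an extension \<open>E\<close> of \<open>G\<close> by \<open>\<mu>\<^sub>2\<close> with inclusion \<open>i\<close>.\<close>

definition signed_word ::
    "'a monoid \<Rightarrow> (int \<Rightarrow> 'a) \<Rightarrow> nat \<Rightarrow> (nat \<Rightarrow> 'a) \<Rightarrow> int \<Rightarrow> (nat \<Rightarrow> int) \<Rightarrow> 'a" where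
  "signed_word E i \<kappa> s l e =
     (i (-1) [^]\<^bsub>E\<^esub> l) \<otimes>\<^bsub>E\<^esub> ordered_prod E (map (\<lambda>j. s j [^]\<^bsub>E\<^esub> e j) [2..<Suc \<kappa>])"

text \<open>\<open>is_twist G \<sigma> \<kappa> n E1 i1 p1 E2 i2 p2\<close> renders \<open>E2 = E1\<^bsup>(2^n, \<sigma> 1)\<^esup>\<close>, where \<open>Ea\<close> is an
  extension of \<open>G\<close> by \<open>\<mu>\<^sub>2\<close> with inclusion \<open>ia\<close> and projection \<open>pa\<close>.\<close>

definition is_twist ::
    "'g monoid \<Rightarrow> (nat \<Rightarrow> 'g) \<Rightarrow> nat \<Rightarrow> nat \<Rightarrow>
     'a monoid \<Rightarrow> (int \<Rightarrow> 'a) \<Rightarrow> ('a \<Rightarrow> 'g) \<Rightarrow>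
     'b monoid \<Rightarrow> (int \<Rightarrow> 'b) \<Rightarrow> ('b \<Rightarrow> 'g) \<Rightarrow> bool" where
  "is_twist G \<sigma> \<kappa> n E1 i1 p1 E2 i2 p2 \<longleftrightarrow>
     short_exact mu2 E1 G i1 p1 \<and> short_exact mu2 E2 G i2 p2 \<and>
     (\<exists>s t.
        (\<forall>i\<in>{1..\<kappa>}. s i \<in> carrier E1 \<and> p1 (s i) = \<sigma> i) \<and>
        (\<forall>i\<in>{1..\<kappa>}. t i \<in> carrier E2 \<and> p2 (t i) = \<sigma> i) \<and>
        group.ord E1 (s 1) = 2 ^ (n - 1) \<and>
        t 1 [^]\<^bsub>E2\<^esub> (2 ^ (n - 1) :: nat) \<in> i2 ` carrier mu2 \<and>
        t 1 [^]\<^bsub>E2\<^esub> (2 ^ (n - 1) :: nat) \<noteq> \<one>\<^bsub>E2\<^esub> \<and>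
        (\<forall>i\<in>{2..\<kappa>}. \<forall>(a::int) l e.
           s i [^]\<^bsub>E1\<^esub> a = signed_word E1 i1 \<kappa> s l e \<longleftrightarrow>
           t i [^]\<^bsub>E2\<^esub> a = signed_word E2 i2 \<kappa> t l e) \<and>
        (\<forall>i\<in>{1..\<kappa>}. \<forall>j\<in>{1..\<kappa>}. \<forall>l e.
           commutator E1 (s i) (s j) = signed_word E1 i1 \<kappa> s l e \<longleftrightarrow>
           commutator E2 (t i) (t j) = signed_word E2 i2 \<kappa> t l e))"

end

theory Submission
  imports Defs
begin

text \<open>For a character \<open>\<psi>\<close> of \<open>G\<close>, the elements \<open>x\<close> of the Clifford group that lie over some
  \<open>g \<in> G\<close> and have \<open>N(x) = \<psi>(g)\<close> form a group. It surjects onto \<open>G\<close>, since the norm of a preimage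
  can be adjusted by a square root in the separably closed field, and the kernel consists of the scalars
  \<open>c\<close> with \<open>c\<^sup>2 = 1\<close>. The trivial character gives the Pin extension and \<open>\<phi>\<close> gives the group sought.
  Both extensions have the same preimages of \<open>\<sigma>\<^sub>i\<close> for \<open>i \<ge> 2\<close>, while those of \<open>\<sigma>\<^sub>1\<close> differ by a
  scalar \<open>c\<close> with \<open>c\<^sup>2 = \<zeta>\<close>. Scalars do not affect commutators, and \<open>c\<close> raised to \<open>2\<close> to the
  \<open>n - 1\<close> is \<open>-1\<close>, so exactly one of the two preimages of \<open>\<sigma>\<^sub>1\<close> has order \<open>2\<close> to the \<open>n - 1\<close>.

  The inputs on Clifford groups come from three elementary facts: isometries are products of
  reflections, homogeneous elements twisted-commuting with all vectors are scalars, and the Clifford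
  algebra is not zero. Together the first two show that the Clifford group consists of the scalar
  multiples of products of anisotropic vectors, on which the norm is visibly multiplicative.\<close>

section \<open>The tensor algebra\<close>

text \<open>No basis theorem for the Clifford algebra is established. Its elements are treated as
  congruence classes of tensors, so that ordinary noncommutative ring arithmetic on representatives
  is available. Even and odd classes are separated by the sign automorphism, because 2 is
  invertible; this alone makes the degree of a unit well defined.

  The representation has to move from the small field to its closure. An identity
  \<open>q (A v) = q v\<close> known at the points of the small space says nothing directly about
  vectors over the larger field. It is therefore restated through the Gram matrix
  \<open>P + transpose P\<close>, which a field embedding carries along; as 2 is nonzero, the Gram
  matrix determines the form. Regularity moves in the same way, as the existence of an inverse of
  the Gram matrix.\<close>

lemma tensor_induct [case_names single add]:
  fixes p :: "('a::field, 'n) tensor"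
  assumes "\<And>w c. P (Poly_Mapping.single w c)"
    and "\<And>a b. P a \<Longrightarrow> P b \<Longrightarrow> P (a + b)"
  shows "P p"
proof (induction p rule: update_induct)
  case const
  show ?case using assms(1)[of 0 0] by simp
next
  case (update f a b)
  have "Poly_Mapping.update a b f = f + Poly_Mapping.single a b"
    using update(1)
    by (intro poly_mapping_eqI) (auto simp: lookup_update lookup_add lookup_single when_def in_keys_iff)
  with update assms show ?case by simp
qed

lemma tensor_scalar_hom:
  "tensor_scalar 0 = 0" "tensor_scalar 1 = 1"
  "tensor_scalar (a + b) = tensor_scalar a + tensor_scalar b"
  "tensor_scalar (a - b) = tensor_scalar a - tensor_scalar b"
  "tensor_scalar (- a) = - tensor_scalar a"
  "tensor_scalar (a * b) = tensor_scalar a * tensor_scalar b"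
  by (simp_all add: tensor_scalar_def single_add single_diff single_uminus mult_single)

lemma tensor_scalar_commute: "tensor_scalar c * p = p * tensor_scalar c"
  by (induction p rule: tensor_induct)
    (simp_all add: tensor_scalar_def mult_single mult.commute algebra_simps)

lemma tensor_vec_add: "tensor_vec (v + w) = tensor_vec v + tensor_vec w"
  by (simp add: tensor_vec_def single_add sum.distrib)

lemma tensor_vec_smult: "tensor_vec (c *s v) = tensor_scalar c * tensor_vec v"
  by (simp add: tensor_vec_def tensor_scalar_def sum_distrib_left mult_single)

lemma tensor_vec_zero [simp]: "tensor_vec 0 = 0"
  by (simp add: tensor_vec_def)

lemma tensor_vec_sum: "tensor_vec (sum f A) = (\<Sum>i\<in>A. tensor_vec (f i))"
  by (induction A rule: infinite_finite_induct) (simp_all add: tensor_vec_add)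

lemma tensor_vec_axis: "tensor_vec (axis i (1::'a::field)) = Poly_Mapping.single (Word [i]) 1"
proof -
  have "tensor_vec (axis i (1::'a)) = (\<Sum>j\<in>UNIV. if j = i then Poly_Mapping.single (Word [i]) 1 else 0)"
    unfolding tensor_vec_def by (intro sum.cong) (auto simp: axis_def)
  then show ?thesis by simp
qed

lemma single_Cons:
  "Poly_Mapping.single (Word (i # w)) c = tensor_vec (axis i 1) * Poly_Mapping.single (Word w) c"
  by (simp add: tensor_vec_axis mult_single plus_word_def)

lemma single_Nil: "Poly_Mapping.single (Word []) c = tensor_scalar c"
  by (simp add: tensor_scalar_def zero_word_def)

text \<open>Peeling letters off the left of a word leaves a scalar. Stated with arbitrary vectors
  instead of letters, the rule no longer refers to the standard basis, so an orthogonal basis can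
  take its place.\<close>

lemma tensor_span_induct [case_names scalar vec add]:
  fixes p :: "('a::field, 'n::finite) tensor"
  assumes scalar: "\<And>c. P (tensor_scalar c)"
    and vec: "\<And>v a. P a \<Longrightarrow> P (tensor_vec v * a)"
    and add: "\<And>a b. P a \<Longrightarrow> P b \<Longrightarrow> P (a + b)"
  shows "P p"
proof (induction p rule: tensor_induct)
  case (single w c)
  have "P (Poly_Mapping.single (Word l) c)" for l
    by (induction l) (simp_all add: single_Nil single_Cons scalar vec)
  then show ?case by (metis word.exhaust)
qed (rule add)

section \<open>Reversal of words\<close>

lemma tensor_rev_hom:
  fixes a b :: "('a::field, 'n) tensor"
  shows "tensor_rev (a + b) = tensor_rev a + tensor_rev b"
    "tensor_rev (Poly_Mapping.single (Word l) c :: ('a, 'n) tensor) = Poly_Mapping.single (Word (rev l)) c"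
proof -
  let ?r = "\<lambda>w::'n word. Word (rev (letters w))"
  have inj: "inj ?r" by (rule inj_on_inverseI[of _ ?r]) simp
  show "tensor_rev (a + b) = tensor_rev a + tensor_rev b"
    unfolding tensor_rev_def by (rule map_key_plus[OF inj])
  show "tensor_rev (Poly_Mapping.single (Word l) c :: ('a, 'n) tensor) = Poly_Mapping.single (Word (rev l)) c"
    unfolding tensor_rev_def using map_key_single[OF inj, of "Word (rev l)" c] by simp
qed

lemma tensor_rev_mult: "tensor_rev (a * b) = tensor_rev b * tensor_rev a"
proof (induction a rule: tensor_induct)
  case (single w c)
  show ?case
  proof (induction b rule: tensor_induct)
    case (single w' c')
    show ?case by (cases w; cases w')
        (simp add: tensor_rev_hom mult_single plus_word_def mult.commute)
  qed (simp add: tensor_rev_hom algebra_simps)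
qed (simp add: tensor_rev_hom algebra_simps)

lemma tensor_rev_rev [simp]: "tensor_rev (tensor_rev a) = a"
proof (induction a rule: tensor_induct)
  case (single w c)
  then show ?case by (cases w) (simp add: tensor_rev_hom)
qed (simp add: tensor_rev_hom)

lemma tensor_rev_scalar [simp]: "tensor_rev (tensor_scalar c) = tensor_scalar c"
  by (simp add: tensor_rev_hom flip: single_Nil)

lemma tensor_rev_vec [simp]: "tensor_rev (tensor_vec v) = tensor_vec v"
proof -
  have "tensor_rev (\<Sum>i\<in>A. Poly_Mapping.single (Word [i]) (v $ i)) =
      (\<Sum>i\<in>A. Poly_Mapping.single (Word [i]) (v $ i))" if "finite A" for A
    using that by induction (simp_all add: tensor_rev_hom tensor_rev_scalar[of 0, unfolded tensor_scalar_hom])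
  then show ?thesis unfolding tensor_vec_def by simp
qed

lemma tensor_rev_diff: "tensor_rev (a - b) = tensor_rev a - tensor_rev b"
  using tensor_rev_hom(1)[of "a - b" b] by simp

section \<open>Parity and the sign automorphism\<close>

definition tensor_sign :: "('a::field, 'n) tensor \<Rightarrow> ('a, 'n) tensor" where
  "tensor_sign = Poly_Mapping.mapp (\<lambda>w c. (- 1) ^ length (letters w) * c)"

lemma lookup_tensor_sign:
  "Poly_Mapping.lookup (tensor_sign p) w = (- 1) ^ length (letters w) * Poly_Mapping.lookup p w"
  by (auto simp: tensor_sign_def lookup_mapp in_keys_iff when_def)

lemma tensor_sign_add: "tensor_sign (a + b) = tensor_sign a + tensor_sign b"
  by (rule poly_mapping_eqI) (simp add: lookup_tensor_sign lookup_add algebra_simps)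

lemma tensor_sign_diff: "tensor_sign (a - b) = tensor_sign a - tensor_sign b"
  by (rule poly_mapping_eqI) (simp add: lookup_tensor_sign lookup_minus algebra_simps)

lemma tensor_sign_single:
  "tensor_sign (Poly_Mapping.single w c) = Poly_Mapping.single w ((- 1) ^ length (letters w) * c)"
  by (rule poly_mapping_eqI) (simp add: lookup_tensor_sign lookup_single when_def)

lemma tensor_sign_mult: "tensor_sign (a * b) = tensor_sign a * tensor_sign b"
proof (induction a rule: tensor_induct)
  case (single w c)
  show ?case
    by (induction b rule: tensor_induct)
      (simp_all add: tensor_sign_single tensor_sign_add mult_single plus_word_def power_add algebra_simps)
qed (simp add: tensor_sign_add algebra_simps)

text \<open>Parity is a truth value, \<open>True\<close> for odd, so that degrees add by
  \<open>\<noteq>\<close>. Zero is homogeneous of both parities.\<close>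

definition tensor_part :: "bool \<Rightarrow> ('a::field, 'n) tensor set" where
  "tensor_part b = {p. \<forall>w\<in>Poly_Mapping.keys p. odd (length (letters w)) = b}"

lemma tensor_sign_part:
  assumes "p \<in> tensor_part b"
  shows "tensor_sign p = (if b then - p else p)"
proof (rule poly_mapping_eqI)
  fix w
  show "Poly_Mapping.lookup (tensor_sign p) w = Poly_Mapping.lookup (if b then - p else p) w"
    using assms by (cases "w \<in> Poly_Mapping.keys p")
      (auto simp: lookup_tensor_sign tensor_part_def in_keys_iff)
qed

lemma tensor_part_add: "p \<in> tensor_part b \<Longrightarrow> p' \<in> tensor_part b \<Longrightarrow> p + p' \<in> tensor_part b"
  using keys_add[of p p'] by (force simp: tensor_part_def)

lemma tensor_part_uminus: "p \<in> tensor_part b \<Longrightarrow> - p \<in> tensor_part b"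
  by (simp add: tensor_part_def in_keys_iff)

lemma tensor_part_mult:
  "p \<in> tensor_part b \<Longrightarrow> p' \<in> tensor_part b' \<Longrightarrow> p * p' \<in> tensor_part (b \<noteq> b')"
  using keys_mult[of p p'] by (fastforce simp: tensor_part_def plus_word_def)

lemma tensor_part_scalar: "tensor_scalar c \<in> tensor_part False"
  by (simp add: tensor_part_def tensor_scalar_def zero_word_def)

lemma tensor_part_zero: "0 \<in> tensor_part b"
  by (simp add: tensor_part_def)

lemma tensor_part_sum: "(\<And>i. i \<in> A \<Longrightarrow> f i \<in> tensor_part b) \<Longrightarrow> sum f A \<in> tensor_part b"
  by (induction A rule: infinite_finite_induct) (auto simp: tensor_part_add tensor_part_zero)

lemma tensor_part_vec: "tensor_vec v \<in> tensor_part True"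
  unfolding tensor_vec_def by (rule tensor_part_sum) (simp add: tensor_part_def)

lemma tensor_sign_scalar: "tensor_sign (tensor_scalar c) = tensor_scalar c"
  by (simp add: tensor_sign_part[OF tensor_part_scalar])

lemma tensor_sign_vec: "tensor_sign (tensor_vec v) = - tensor_vec v"
  by (simp add: tensor_sign_part[OF tensor_part_vec])

section \<open>Isometries of a regular quadratic space\<close>

text \<open>The coefficient matrix need not be symmetric, so the Gram matrix of the polar form is
  \<open>Q + transpose Q\<close>.\<close>

lemma polar_qform: "polar (qform Q) v w = (\<Sum>i\<in>UNIV. \<Sum>j\<in>UNIV. (Q $ i $ j + Q $ j $ i) * (v $ i * w $ j))"
proof -
  have "polar (qform Q) v w = (\<Sum>i\<in>UNIV. \<Sum>j\<in>UNIV. Q $ i $ j * v $ i * w $ j + Q $ i $ j * w $ i * v $ j)"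
    by (simp add: polar_def qform_def algebra_simps sum.distrib flip: sum_subtractf)
  also have "\<dots> = (\<Sum>i\<in>UNIV. \<Sum>j\<in>UNIV. Q $ i $ j * v $ i * w $ j) +
      (\<Sum>i\<in>UNIV. \<Sum>j\<in>UNIV. Q $ j $ i * w $ j * v $ i)"
    by (simp add: sum.distrib) (subst sum.swap, rule refl)
  finally show ?thesis by (simp add: sum.distrib algebra_simps)
qed

lemma qform_smult: "qform P (c *s v) = c\<^sup>2 * qform P v"
  by (simp add: qform_def sum_distrib_left power2_eq_square algebra_simps)

lemma polar_qform_self: "polar (qform P) v v = 2 * qform P v"
proof -
  have "v + v = 2 *s v" by (simp flip: vec.scale_left_distrib[of 1 1, simplified])
  then show ?thesis by (simp add: polar_def qform_smult power2_eq_square)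
qed

text \<open>The form is a parameter besides its matrix because the Clifford algebra depends only on
  the function \<open>q\<close>.\<close>

locale regular_space =
  fixes Q :: "'a::field ^ 'n::finite ^ 'n" and q :: "'a ^ 'n \<Rightarrow> 'a"
  assumes q_eq: "q = qform Q" and regular: "regular_form q" and two: "(2::'a) \<noteq> 0"
begin

abbreviation B :: "'a ^ 'n \<Rightarrow> 'a ^ 'n \<Rightarrow> 'a" where "B \<equiv> polar q"

lemma q_add: "q (v + w) = q v + q w + B v w"
  by (simp add: polar_def)

lemma polar_expand: "B v w = (\<Sum>i\<in>UNIV. \<Sum>j\<in>UNIV. (Q $ i $ j + Q $ j $ i) * (v $ i * w $ j))"
  unfolding q_eq by (rule polar_qform)

lemma polar_sym: "B v w = B w v"
  by (simp add: polar_def add.commute)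

lemma polar_add_left: "B (u + v) w = B u w + B v w"
  by (simp add: polar_expand algebra_simps sum.distrib)

lemma polar_smult_left: "B (c *s v) w = c * B v w"
  by (simp add: polar_expand sum_distrib_left algebra_simps)

lemma polar_add_right: "B w (u + v) = B w u + B w v"
  using polar_add_left polar_sym by metis

lemma polar_smult_right: "B w (c *s v) = c * B w v"
  using polar_smult_left polar_sym by metis

lemma polar_zero_left [simp]: "B 0 w = 0"
  using polar_smult_left[of 0 0 w] by simp

lemma polar_uminus_left: "B (- v) w = - B v w"
  using polar_add_left[of v "- v" w] by (simp add: eq_neg_iff_add_eq_0 add.commute)

lemma polar_diff_left: "B (u - v) w = B u w - B v w"
  using polar_add_left[of "u - v" v w] by simp

lemma polar_diff_right: "B w (u - v) = B w u - B w v"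
  using polar_diff_left polar_sym by metis

lemma polar_sum_left: "B (sum f A) w = (\<Sum>i\<in>A. B (f i) w)"
  by (induction A rule: infinite_finite_induct) (simp_all add: polar_add_left)

lemma q_smult: "q (c *s v) = c\<^sup>2 * q v"
  unfolding q_eq by (rule qform_smult)

lemma polar_self: "B v v = 2 * q v"
  unfolding q_eq by (rule polar_qform_self)

lemma q_diff: "q (v - w) = q v + q w - B v w"
proof -
  have "q (- w) = q w" using q_smult[of "-1" w] by simp
  then show ?thesis using q_add[of v "- w"] polar_uminus_left[of w v]
    by (simp add: polar_sym)
qed

lemma q_eq_of_polar: "B v v = B w w \<Longrightarrow> q v = q w"
  using two by (simp add: polar_self)

lemma nondegenerate: "(\<And>w. B v w = 0) \<Longrightarrow> v = 0"
  using regular by (auto simp: regular_form_def)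

lemma polar_left_eqI: "(\<And>w. B v w = B v' w) \<Longrightarrow> v = v'"
  using nondegenerate[of "v - v'"] by (simp add: polar_diff_left)

section \<open>Orthogonal bases\<close>

definition orthogonal_family :: "(nat \<Rightarrow> 'a ^ 'n) \<Rightarrow> nat \<Rightarrow> bool" where
  "orthogonal_family e N \<longleftrightarrow>
     (\<forall>i<N. q (e i) \<noteq> 0) \<and> (\<forall>i<N. \<forall>j<N. i \<noteq> j \<longrightarrow> B (e i) (e j) = 0)"

text \<open>Pairing a linear relation with \<open>e j\<close> leaves only its coefficient at
  \<open>j\<close>, times \<open>2 * q (e j)\<close>, so the family is independent. The bound is
  what makes a longest family exist.\<close>

lemma orthogonal_family_bound:
  assumes e: "orthogonal_family e N"
  shows "N \<le> CARD('n)"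
proof -
  have coeff: "B (\<Sum>i<N. u i *s e i) (e j) = u j * (2 * q (e j))" if "j < N" for u j
  proof -
    have "B (\<Sum>i<N. u i *s e i) (e j) = (\<Sum>i<N. if i = j then u j * (2 * q (e j)) else 0)"
      unfolding polar_sum_left polar_smult_left
      using e that by (intro sum.cong) (auto simp: orthogonal_family_def polar_self)
    with that show ?thesis by simp
  qed
  have inj: "inj_on e {..<N}"
    using e two by (intro inj_onI) (metis lessThan_iff orthogonal_family_def polar_self mult_eq_0_iff)
  have "vec.independent (e ` {..<N})"
  proof (subst vec.independent_explicit_finite_subsets, intro allI impI ballI)
    fix S u x assume S: "S \<subseteq> e ` {..<N}" "finite S" "(\<Sum>x\<in>S. u x *s x) = 0" "x \<in> S"
    \<comment> \<open>Extension by zero, so that the relation runs over the whole family.\<close>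
    define u' where "u' = (\<lambda>x. if x \<in> S then u x else 0)"
    have "(\<Sum>i<N. u' (e i) *s e i) = (\<Sum>x\<in>e ` {..<N}. u' x *s x)"
      using inj by (simp add: sum.reindex)
    also have "\<dots> = (\<Sum>x\<in>S. u' x *s x)"
      using S by (intro sum.mono_neutral_right) (auto simp: u'_def)
    also have "\<dots> = 0" using S by (simp add: u'_def)
    finally have "(\<Sum>i<N. u' (e i) *s e i) = 0" .
    moreover obtain j where j: "j < N" "x = e j" using S by auto
    ultimately have "u' (e j) * (2 * q (e j)) = 0" using coeff[of j "\<lambda>i. u' (e i)"] by simp
    then show "u x = 0" using j S e two by (simp add: u'_def orthogonal_family_def)
  qed
  then have "card (e ` {..<N}) \<le> vec.dim (UNIV :: ('a ^ 'n) set)"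
    using vec.independent_card_le_dim by blast
  with inj show ?thesis by (simp add: card_image vec_dim_card del: vec.dim_UNIV)
qed

text \<open>For a family of maximal length every vector orthogonal to it is isotropic. By
  polarization the polar form then vanishes on the orthogonal complement, and regularity forces the
  complement to be zero. The denominators are \<open>B (e i) (e i)\<close>.\<close>

lemma orthogonal_basis_exists:
  "\<exists>e N. orthogonal_family e N \<and> (\<forall>v. v = (\<Sum>i<N. (B v (e i) / (2 * q (e i))) *s e i))"
proof -
  define L where "L = (\<lambda>N. \<exists>e. orthogonal_family e N)"
  have "L 0" by (simp add: L_def orthogonal_family_def)
  then have "L (Greatest L)"
    by (rule GreatestI_nat[where b = "CARD('n)"]) (auto simp: L_def orthogonal_family_bound)
  then obtain N e where N: "N = Greatest L" and e: "orthogonal_family e N"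
    by (auto simp: L_def)
  have no_ext: False if x: "q x \<noteq> 0" "\<And>j. j < N \<Longrightarrow> B x (e j) = 0" for x
  proof -
    have "orthogonal_family (e(N := x)) (Suc N)"
      using e x by (auto simp: orthogonal_family_def less_Suc_eq polar_sym)
    then have "Suc N \<le> N" unfolding N
      by (intro Greatest_le_nat[where b = "CARD('n)"]) (auto simp: L_def orthogonal_family_bound)
    then show False by simp
  qed
  \<comment> \<open>The component of \<open>v\<close> orthogonal to the family.\<close>
  define P where "P = (\<lambda>v. v - (\<Sum>i<N. (B v (e i) / (2 * q (e i))) *s e i))"
  have P: "B (P v) (e j) = 0" if "j < N" for v j
  proof -
    have "B (\<Sum>i<N. (B v (e i) / (2 * q (e i))) *s e i) (e j) = (\<Sum>i<N. if i = j then B v (e j) else 0)"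
      unfolding polar_sum_left polar_smult_left
      using e that two by (intro sum.cong) (auto simp: orthogonal_family_def polar_self)
    with that show ?thesis by (simp add: P_def polar_diff_left)
  qed
  have q0: "q x = 0" if "\<And>j. j < N \<Longrightarrow> B x (e j) = 0" for x
    using no_ext[of x] that by blast
  have "P v = 0" for v
  proof (rule nondegenerate)
    fix w
    \<comment> \<open>\<open>q\<close> vanishes on \<open>P v\<close>, on \<open>P w\<close> and on
      their sum, all three being orthogonal to the family.\<close>
    have "B (P v) (P w) = 0"
      unfolding polar_def by (simp add: q0 P polar_add_left)
    moreover have "B (P v) (P w) = B (P v) w"
    proof -
      have "B (P v) (\<Sum>i<N. (B w (e i) / (2 * q (e i))) *s e i) = 0"
        unfolding polar_sym[of "P v"] polar_sum_left polar_smult_left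
        using P by (simp add: polar_sym)
      then show ?thesis by (simp add: P_def polar_diff_right)
    qed
    ultimately show "B (P v) w = 0" by simp
  qed
  then show ?thesis using e by (force simp: P_def)
qed

section \<open>Reflections\<close>

definition reflection :: "'a ^ 'n \<Rightarrow> 'a ^ 'n \<Rightarrow> 'a ^ 'n" where
  "reflection z u = u - (B u z / q z) *s z"

lemma reflection_isometry:
  assumes "q z \<noteq> 0"
  shows "B (reflection z u) (reflection z v) = B u v"
  using assms
  by (simp add: reflection_def polar_diff_left polar_diff_right polar_smult_left
      polar_smult_right polar_self polar_sym[of z] field_simps)

lemma reflection_reflection:
  assumes "q z \<noteq> 0"
  shows "reflection z (reflection z u) = u"
  using assms
  by (simp add: reflection_def polar_diff_left polar_smult_left polar_self vec.scale_left_diff_distrib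
      flip: vec.scale_left_distrib)

lemma reflection_fixes: "B u z = 0 \<Longrightarrow> reflection z u = u"
  by (simp add: reflection_def)

text \<open>Equal values of \<open>q\<close> give \<open>B b (b - a) = q (b - a)\<close>, so exactly
  one copy of \<open>b - a\<close> is subtracted from \<open>b\<close>.\<close>

lemma reflection_swap:
  assumes "q a = q b" "q (b - a) \<noteq> 0"
  shows "reflection (b - a) b = a"
proof -
  have "B b (b - a) = q (b - a)"
    using assms(1) by (simp add: polar_diff_right q_diff polar_self polar_sym[of a b])
  with assms(2) show ?thesis by (simp add: reflection_def)
qed

lemma reflection_uminus: "q a \<noteq> 0 \<Longrightarrow> reflection a (- a) = a"
  by (simp add: reflection_def polar_uminus_left polar_self vec.scale_left_distrib
      vec.scale_minus_left flip: vec.scale_left_distrib[of 1 1 a, simplified])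

text \<open>The weak form of the Cartan--Dieudonne theorem, as an induction principle.\<close>

lemma isometry_induct [consumes 1, case_names id reflection]:
  assumes f: "\<And>u v. B (f u) (f v) = B u v"
    and id: "P (\<lambda>u. u)"
    and step: "\<And>z f. q z \<noteq> 0 \<Longrightarrow> P f \<Longrightarrow> P (\<lambda>u. reflection z (f u))"
  shows "P f"
proof -
  obtain e N where e: "orthogonal_family e N"
    and basis: "\<And>v. v = (\<Sum>i<N. (B v (e i) / (2 * q (e i))) *s e i)"
    using orthogonal_basis_exists by blast
  \<comment> \<open>Downward induction on the number \<open>k\<close> of basis vectors that
    \<open>f\<close> already fixes. At \<open>k = N\<close> the isometry is the identity; at each
    stage one or two reflections make it fix \<open>e k\<close> as well.\<close>
  have "P f" if "k \<le> N" "\<And>u v. B (f u) (f v) = B u v" "\<And>i. i < k \<Longrightarrow> f (e i) = e i" for k f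
    using that
  proof (induction k arbitrary: f rule: inc_induct)
    case base
    have "f u = u" for u
    proof -
      have "B (f u) (e i) = B u (e i)" if "i < N" for i
        using base that by metis
      then show ?thesis using basis[of u] basis[of "f u"] by simp
    qed
    then have "f = (\<lambda>u. u)" by blast
    with id show ?case by simp
  next
    case (step k)
    let ?a = "e k" and ?b = "f (e k)"
    have qab: "q ?a = q ?b" using step.prems(1) by (metis q_eq_of_polar)
    have qa: "q ?a \<noteq> 0" using e step.hyps by (simp add: orthogonal_family_def)
    \<comment> \<open>Hence reflecting in \<open>?a\<close>, \<open>?b - ?a\<close> or
      \<open>?b + ?a\<close> leaves the vectors already fixed in place.\<close>
    have orth: "B (e i) ?a = 0" "B (e i) ?b = 0" if "i < k" for i
      using that e step.hyps step.prems(1)[of "e i" "e k"] step.prems(2)[of i]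
      by (auto simp: orthogonal_family_def)
    show ?case
    proof (cases "q (?b - ?a) = 0")
      case False
      have "P (\<lambda>u. reflection (?b - ?a) (f u))"
        using step.prems orth False qab
        by (intro step.IH)
          (auto simp: reflection_isometry less_Suc_eq reflection_swap reflection_fixes polar_diff_right)
      from assms(3)[OF False this] show ?thesis
        by (simp add: reflection_reflection[OF False])
    next
      case True
      \<comment> \<open>By the parallelogram law \<open>?b - ?a\<close> and \<open>?b + ?a\<close>
        cannot both be isotropic. In this case the reflection in \<open>?b + ?a\<close> sends
        \<open>?b\<close> to \<open>- ?a\<close>, and the one in \<open>?a\<close> repairs the
        sign.\<close>
      have "q (?b + ?a) + q (?b - ?a) = 2 * (2 * q ?a)"
        using qab by (simp add: q_add q_diff)
      with True two qa have nz: "q (?b + ?a) \<noteq> 0"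
        by (metis add_0_right mult_eq_0_iff)
      have "q (- ?a) = q ?a" using q_smult[of "-1" ?a] by simp
      then have "reflection (?b + ?a) ?b = - ?a"
        using reflection_swap[of "- ?a" ?b] nz qab by simp
      then have "P (\<lambda>u. reflection ?a (reflection (?b + ?a) (f u)))"
        using step.prems orth nz qa
        by (intro step.IH)
          (auto simp: reflection_isometry less_Suc_eq reflection_uminus reflection_fixes polar_add_right)
      from assms(3)[OF nz assms(3)[OF qa this]] show ?thesis
        by (simp add: reflection_reflection[OF nz] reflection_reflection[OF qa])
    qed
  qed
  from this[of 0 f] f show ?thesis by simp
qed

end

section \<open>The Clifford algebra\<close>

lemma tensor_ring_simps [simp]:
  "carrier ring_of_type_algebra = UNIV"
  "a \<otimes>\<^bsub>ring_of_type_algebra\<^esub> b = a * b"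
  "a \<oplus>\<^bsub>ring_of_type_algebra\<^esub> b = a + b"
  "\<one>\<^bsub>ring_of_type_algebra\<^esub> = 1"
  "\<zero>\<^bsub>ring_of_type_algebra\<^esub> = 0"
  by (simp_all add: ring_of_type_algebra_def)

lemma ring_ring_of_type_algebra: "ring (ring_of_type_algebra :: 'r::ring_1 ring)"
proof (intro ringI abelian_groupI monoidI)
  show "\<exists>y\<in>carrier ring_of_type_algebra. y \<oplus>\<^bsub>ring_of_type_algebra\<^esub> x = \<zero>\<^bsub>ring_of_type_algebra\<^esub>"
    for x :: 'r by (rule bexI[of _ "- x"]) simp_all
qed (simp_all add: algebra_simps)

lemma ideal_ring_of_type_algebraI:
  fixes I :: "'r::ring_1 set"
  assumes "0 \<in> I" "\<And>a b. a \<in> I \<Longrightarrow> b \<in> I \<Longrightarrow> a + b \<in> I"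
    and "\<And>a. a \<in> I \<Longrightarrow> - a \<in> I"
    and "\<And>a x. a \<in> I \<Longrightarrow> x * a \<in> I" "\<And>a x. a \<in> I \<Longrightarrow> a * x \<in> I"
  shows "ideal I ring_of_type_algebra"
proof (rule idealI)
  show "ring (ring_of_type_algebra :: 'r ring)" by (rule ring_ring_of_type_algebra)
  interpret R: ring "ring_of_type_algebra :: 'r ring" by (rule ring_ring_of_type_algebra)
  have inv: "inv\<^bsub>add_monoid ring_of_type_algebra\<^esub> a = - a" for a :: 'r
    using R.minus_equality[of "- a" a] by (simp add: a_inv_def)
  show "subgroup I (add_monoid (ring_of_type_algebra :: 'r ring))"
    by (rule subgroup.intro) (use assms inv in auto)
qed (use assms in auto)

context regular_space
begin

abbreviation C where "C \<equiv> clifford_algebra q"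
abbreviation cl where "cl \<equiv> cl_class q"
abbreviation sc where "sc \<equiv> cl_scalar q"
abbreviation vec where "vec \<equiv> cl_vec q"
abbreviation I where "I \<equiv> clifford_ideal q"

section \<open>The Clifford ideal and congruences modulo it\<close>

lemma clifford_ideal: "ideal I tensor_ring"
  unfolding clifford_ideal_def
  by (rule ring.genideal_ideal[OF ring_ring_of_type_algebra]) simp

lemma clifford_ideal_zero: "0 \<in> I"
  and clifford_ideal_add: "a \<in> I \<Longrightarrow> b \<in> I \<Longrightarrow> a + b \<in> I"
  and clifford_ideal_mult: "a \<in> I \<Longrightarrow> x * a \<in> I" "a \<in> I \<Longrightarrow> a * x \<in> I"
proof -
  interpret ideal I tensor_ring by (rule clifford_ideal)
  show "0 \<in> I" using additive_subgroup.zero_closed[OF is_additive_subgroup] by simp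
  show "a \<in> I \<Longrightarrow> b \<in> I \<Longrightarrow> a + b \<in> I" using additive_subgroup.a_closed[OF is_additive_subgroup] by simp
  show "a \<in> I \<Longrightarrow> x * a \<in> I" "a \<in> I \<Longrightarrow> a * x \<in> I"
    using I_l_closed[of a x] I_r_closed[of a x] by simp_all
qed

lemma clifford_ideal_uminus: "a \<in> I \<Longrightarrow> - a \<in> I"
  using clifford_ideal_mult(1)[of a "-1"] by simp

lemma clifford_ideal_diff: "a \<in> I \<Longrightarrow> b \<in> I \<Longrightarrow> a - b \<in> I"
  using clifford_ideal_add[of a "- b"] clifford_ideal_uminus[of b] by simp

lemma clifford_ideal_gen: "tensor_vec v * tensor_vec v - tensor_scalar (q v) \<in> I"
  unfolding clifford_ideal_def
  using ring.genideal_self[OF ring_ring_of_type_algebra] by force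

lemma clifford_ideal_minimal:
  assumes "ideal J tensor_ring" "\<And>v. tensor_vec v * tensor_vec v - tensor_scalar (q v) \<in> J"
  shows "I \<subseteq> J"
  unfolding clifford_ideal_def
  by (rule ring.genideal_minimal[OF ring_ring_of_type_algebra assms(1)]) (use assms(2) in auto)

text \<open>The preimage of the ideal under this automorphism is again an ideal and contains the
  generators, which are even; minimality does the rest. The same argument works for reversal, which
  fixes the generators and exchanges left and right multiples.\<close>

lemma tensor_sign_ideal: "a \<in> I \<Longrightarrow> tensor_sign a \<in> I"
proof -
  have [simp]: "tensor_sign 0 = 0" "tensor_sign (- x) = - tensor_sign x" for x :: "('a, 'n) tensor"
    using tensor_sign_diff[of 0 0] tensor_sign_diff[of 0 x] by simp_all
  have "I \<subseteq> {a. tensor_sign a \<in> I}"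
    by (rule clifford_ideal_minimal, rule ideal_ring_of_type_algebraI)
      (auto simp: tensor_sign_add tensor_sign_mult clifford_ideal_zero clifford_ideal_add
        clifford_ideal_mult clifford_ideal_uminus tensor_sign_diff tensor_sign_vec
        tensor_sign_scalar clifford_ideal_gen)
  then show "a \<in> I \<Longrightarrow> tensor_sign a \<in> I" by blast
qed

lemma tensor_rev_ideal: "a \<in> I \<Longrightarrow> tensor_rev a \<in> I"
proof -
  have [simp]: "tensor_rev 0 = 0" "tensor_rev (- x) = - tensor_rev x" for x :: "('a, 'n) tensor"
    using tensor_rev_diff[of 0 0] tensor_rev_diff[of 0 x] by simp_all
  have "I \<subseteq> {a. tensor_rev a \<in> I}"
    by (rule clifford_ideal_minimal, rule ideal_ring_of_type_algebraI)
      (auto simp: tensor_rev_hom tensor_rev_mult clifford_ideal_zero clifford_ideal_add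
        clifford_ideal_mult clifford_ideal_uminus tensor_rev_diff clifford_ideal_gen)
  then show "a \<in> I \<Longrightarrow> tensor_rev a \<in> I" by blast
qed

lemma cl_class_eq: "cl p = {i + p | i. i \<in> I}"
  by (auto simp: cl_class_def a_r_coset_def')

lemma cl_eq_iff: "cl a = cl b \<longleftrightarrow> a - b \<in> I"
proof
  assume "cl a = cl b"
  moreover have "a \<in> cl a" using clifford_ideal_zero by (force simp: cl_class_eq)
  ultimately show "a - b \<in> I" by (auto simp: cl_class_eq)
next
  assume ab: "a - b \<in> I"
  have "i + a = (i + (a - b)) + b" "i + b = (i - (a - b)) + a" for i by simp_all
  then show "cl a = cl b"
    unfolding cl_class_eq using ab clifford_ideal_add clifford_ideal_diff by blast
qed

sublocale C: ring C
  unfolding clifford_algebra_def by (rule ideal.quotient_is_ring[OF clifford_ideal])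

lemma carrier_C: "carrier C = range cl"
  by (auto simp: clifford_algebra_def FactRing_def A_RCOSETS_def' cl_class_def)

lemma cl_closed [simp, intro]: "cl a \<in> carrier C"
  by (simp add: carrier_C)

lemma cl_mult: "cl (a * b) = cl a \<otimes>\<^bsub>C\<^esub> cl b"
  and cl_add: "cl (a + b) = cl a \<oplus>\<^bsub>C\<^esub> cl b"
  and cl_one: "cl 1 = \<one>\<^bsub>C\<^esub>"
proof -
  have h: "(+>\<^bsub>tensor_ring\<^esub>) I \<in> ring_hom tensor_ring C"
    unfolding clifford_algebra_def by (rule ideal.rcos_ring_hom[OF clifford_ideal])
  show "cl (a * b) = cl a \<otimes>\<^bsub>C\<^esub> cl b" "cl (a + b) = cl a \<oplus>\<^bsub>C\<^esub> cl b" "cl 1 = \<one>\<^bsub>C\<^esub>"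
    using ring_hom_mult[OF h, of a b] ring_hom_add[OF h, of a b] ring_hom_one[OF h]
    by (simp_all add: cl_class_def)
qed

text \<open>These rules allow rewriting under \<open>cl\<close>, so that calculations in the
  quotient run on tensors.\<close>

lemma cl_cong_add: "cl a = cl a' \<Longrightarrow> cl b = cl b' \<Longrightarrow> cl (a + b) = cl (a' + b')"
  by (simp add: cl_add)

lemma cl_cong_mult: "cl a = cl a' \<Longrightarrow> cl b = cl b' \<Longrightarrow> cl (a * b) = cl (a' * b')"
  by (simp add: cl_mult)

lemma cl_cong_uminus: "cl a = cl a' \<Longrightarrow> cl (- a) = cl (- a')"
  using cl_cong_mult[of "-1" "-1" a a'] by simp

lemma cl_vec_square: "cl (tensor_vec v * tensor_vec v) = cl (tensor_scalar (q v))"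
  by (simp add: cl_eq_iff clifford_ideal_gen)

text \<open>Polarization: the generator at \<open>v + w\<close> minus the generators at
  \<open>v\<close> and at \<open>w\<close>.\<close>

lemma cl_vec_polar:
  "cl (tensor_vec v * tensor_vec w) = cl (tensor_scalar (B v w) - tensor_vec w * tensor_vec v)"
proof -
  have "(tensor_vec (v + w) * tensor_vec (v + w) - tensor_scalar (q (v + w))) -
      (tensor_vec v * tensor_vec v - tensor_scalar (q v)) -
      (tensor_vec w * tensor_vec w - tensor_scalar (q w)) \<in> I"
    by (intro clifford_ideal_diff clifford_ideal_gen)
  then show ?thesis
    by (simp add: cl_eq_iff tensor_vec_add q_add tensor_scalar_hom algebra_simps)
qed

lemma cl_involution_cl: "cl_involution (cl a) = cl (tensor_rev a)"
proof -
  have "tensor_rev ` cl a \<subseteq> cl (tensor_rev a)"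
    by (auto simp: cl_class_eq tensor_rev_hom tensor_rev_ideal)
  \<comment> \<open>Reversal is its own inverse, which gives the opposite inclusion.\<close>
  moreover have "cl (tensor_rev a) \<subseteq> tensor_rev ` cl a"
  proof
    fix x assume "x \<in> cl (tensor_rev a)"
    then obtain i where "i \<in> I" "x = i + tensor_rev a" by (auto simp: cl_class_eq)
    then have "x = tensor_rev (tensor_rev i + a)" "tensor_rev i + a \<in> cl a"
      by (auto simp: cl_class_eq tensor_rev_hom tensor_rev_ideal)
    then show "x \<in> tensor_rev ` cl a" by blast
  qed
  ultimately show ?thesis by (simp add: cl_involution_def subset_antisym)
qed

lemma cl_sign_cong: "cl a = cl b \<Longrightarrow> cl (tensor_sign a) = cl (tensor_sign b)"
  using tensor_sign_ideal[of "a - b"] by (simp add: cl_eq_iff tensor_sign_diff)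

lemma cl_scalar_mult_eq_zero:
  assumes "cl (tensor_scalar c * a) = cl 0" "c \<noteq> 0"
  shows "cl a = cl 0"
proof -
  have "tensor_scalar (1 / c) * (tensor_scalar c * a) = a"
    using assms(2) by (simp add: tensor_scalar_hom(2) flip: mult.assoc tensor_scalar_hom(6))
  with cl_cong_mult[OF refl assms(1), of "tensor_scalar (1 / c)"] show ?thesis by simp
qed

text \<open>The sign automorphism descends to the quotient. Computed on \<open>a\<close> it fixes
  the common class, computed on \<open>b\<close> it negates it, so twice the class is zero.\<close>

lemma cl_homogeneous_disjoint:
  assumes "a \<in> tensor_part False" "b \<in> tensor_part True" "cl a = cl b"
  shows "cl a = cl 0"
proof -
  have "cl a = cl (- b)"
    using cl_sign_cong[OF assms(3)] assms(1,2) by (simp add: tensor_sign_part)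
  then have "cl (a + a) = cl (b + - b)" using assms(3) by (rule cl_cong_add[rotated])
  then have "cl (a + a) = cl 0" by (simp only: add.right_inverse)
  moreover have "a + a = tensor_scalar 2 * a"
  proof -
    have "tensor_scalar 2 = (2 :: ('a, 'n) tensor)"
      using tensor_scalar_hom(3)[of "1::'a" 1] by (simp add: tensor_scalar_hom(2))
    then show ?thesis by (simp add: mult_2)
  qed
  ultimately have "cl (tensor_scalar 2 * a) = cl 0" by (simp only:)
  then show ?thesis by (rule cl_scalar_mult_eq_zero) (rule two)
qed

end

section \<open>Nontriviality of the Clifford algebra\<close>

definition linear_operator :: "(('s \<Rightarrow> 'a) \<Rightarrow> 's \<Rightarrow> 'a::field) \<Rightarrow> bool" where
  "linear_operator g \<longleftrightarrow> (\<forall>a b f h s. g (\<lambda>s. a * f s + b * h s) s = a * g f s + b * g h s)"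

lemma linear_operatorD:
  assumes "linear_operator g"
  shows "g (\<lambda>s. f s + h s) s = g f s + g h s" "g (\<lambda>s. c * f s) s = c * g f s" "g (\<lambda>s. 0) s = 0"
  using assms[unfolded linear_operator_def, rule_format, of 1 f 1 h s]
    assms[unfolded linear_operator_def, rule_format, of c f 0 f s]
    assms[unfolded linear_operator_def, rule_format, of 0 f 0 f s] by simp_all

text \<open>The universal property of the free algebra in concrete form: letter \<open>i\<close>
  acts as \<open>g i\<close>, and with \<open>foldr\<close> the leftmost letter acts last, so
  products become compositions.\<close>

definition tensor_action ::
    "('n \<Rightarrow> ('s \<Rightarrow> 'a) \<Rightarrow> 's \<Rightarrow> 'a) \<Rightarrow> ('a::field, 'n) tensor \<Rightarrow> ('s \<Rightarrow> 'a) \<Rightarrow> 's \<Rightarrow> 'a" where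
  "tensor_action g p f = (\<lambda>s. \<Sum>w\<in>Poly_Mapping.keys p. Poly_Mapping.lookup p w * foldr g (letters w) f s)"

lemma tensor_action_single:
  "tensor_action g (Poly_Mapping.single w c) f s = c * foldr g (letters w) f s"
  by (simp add: tensor_action_def)

lemma tensor_action_add:
  "tensor_action g (p + p') f s = tensor_action g p f s + tensor_action g p' f s"
  unfolding tensor_action_def
  by (rule setsum_keys_plus_distrib) (simp_all add: distrib_right)

lemma tensor_action_sum:
  "tensor_action g (sum p A) f s = (\<Sum>i\<in>A. tensor_action g (p i) f s)"
  by (induction A rule: infinite_finite_induct)
    (simp_all add: tensor_action_add, simp_all add: tensor_action_def)

lemma linear_operator_foldr:
  assumes "\<And>i. linear_operator (g i)"
  shows "linear_operator (foldr g l)"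
proof (induction l)
  case (Cons i l)
  have "foldr g l (\<lambda>s. a * f s + b * h s) = (\<lambda>s. a * foldr g l f s + b * foldr g l h s)" for a b f h
    using Cons by (simp add: linear_operator_def fun_eq_iff)
  then show ?case
    using assms[of i] by (simp add: linear_operator_def)
qed (simp add: linear_operator_def)

lemma linear_operator_tensor_action:
  assumes "\<And>i. linear_operator (g i)"
  shows "linear_operator (tensor_action g p)"
  using linear_operator_foldr[of g, OF assms] unfolding linear_operator_def tensor_action_def
  by (simp add: sum_distrib_left sum.distrib algebra_simps)

lemma tensor_action_mult:
  assumes lin: "\<And>i. linear_operator (g i)"
  shows "tensor_action g (p * p') f = tensor_action g p (tensor_action g p' f)"
proof (rule ext)
  fix s
  note D = linear_operatorD[OF linear_operator_foldr[of g, OF lin]]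
    linear_operatorD[OF linear_operator_tensor_action[of g, OF lin]]
  show "tensor_action g (p * p') f s = tensor_action g p (tensor_action g p' f) s"
  proof (induction p rule: tensor_induct)
    case (single w c)
    show ?case
    proof (induction p' rule: tensor_induct)
      case (single w' c')
      have "tensor_action g (Poly_Mapping.single w' c') f = (\<lambda>s. c' * foldr g (letters w') f s)"
        by (simp add: tensor_action_single fun_eq_iff)
      then show ?case
        by (simp add: mult_single tensor_action_single plus_word_def D(2))
    next
      case (add a b)
      have "tensor_action g (a + b) f = (\<lambda>s. tensor_action g a f s + tensor_action g b f s)"
        by (simp add: tensor_action_add fun_eq_iff)
      with add show ?case by (simp add: tensor_action_add distrib_left D(4))
    qed
  qed (simp add: distrib_right tensor_action_add)
qed

lemma tensor_action_scalar: "tensor_action g (tensor_scalar c) f s = c * f s"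
  by (simp add: tensor_action_single zero_word_def tensor_scalar_def)

lemma tensor_action_vec: "tensor_action g (tensor_vec v) f s = (\<Sum>i\<in>UNIV. v $ i * g i f s)"
  by (simp add: tensor_vec_def tensor_action_sum tensor_action_single)

lemma tensor_action_uminus: "tensor_action g (- p) f s = - tensor_action g p f s"
  using tensor_action_add[of g p "- p" f s] by (simp add: tensor_action_def eq_neg_iff_add_eq_0 add.commute)

lemma tensor_action_diff:
  "tensor_action g (p - p') f s = tensor_action g p f s - tensor_action g p' f s"
  using tensor_action_add[of g p "- p'" f s] by (simp add: tensor_action_uminus)

text \<open>Left multiplication by an orthogonal basis vector on the exterior-algebra basis indexed by
  sets of basis indices: toggle \<open>i\<close>, with the sign from moving past the smaller indices.\<close>

definition toggle :: "nat \<Rightarrow> nat set \<Rightarrow> nat set" where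
  "toggle i S = (if i \<in> S then S - {i} else insert i S)"

definition toggle_op :: "(nat \<Rightarrow> 'a::field) \<Rightarrow> nat \<Rightarrow> (nat set \<Rightarrow> 'a) \<Rightarrow> nat set \<Rightarrow> 'a" where
  "toggle_op d i f S = (\<Prod>j<i. if j \<in> S then - 1 else 1) * (if i \<in> S then d i else 1) * f (toggle i S)"

lemma toggle_toggle: "toggle i (toggle i S) = S" "toggle i (toggle j S) = toggle j (toggle i S)"
  by (auto simp: toggle_def)

lemma toggle_sign:
  "(\<Prod>j<i. if j \<in> toggle k S then - 1 else (1::'a::field)) =
     (if k < i then - 1 else 1) * (\<Prod>j<i. if j \<in> S then - 1 else 1)"
proof (cases "k < i")
  case True
  then have i: "prod h {..<i} = h k * prod h ({..<i} - {k})" for h :: "nat \<Rightarrow> 'a"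
    by (intro prod.remove) auto
  have "(\<Prod>j\<in>{..<i} - {k}. if j \<in> toggle k S then - 1 else (1::'a)) =
      (\<Prod>j\<in>{..<i} - {k}. if j \<in> S then - 1 else 1)"
    by (intro prod.cong) (auto simp: toggle_def)
  with True show ?thesis
    unfolding i[of "\<lambda>j. if j \<in> toggle k S then - 1 else 1"] i[of "\<lambda>j. if j \<in> S then - 1 else 1"]
    by (simp add: toggle_def)
next
  case False
  then show ?thesis by (simp, intro prod.cong) (auto simp: toggle_def)
qed

text \<open>The sign occurs twice and cancels, and exactly one of \<open>S\<close> and
  \<open>toggle i S\<close> contains \<open>i\<close>, so the factor \<open>d i\<close> appears
  once.\<close>

lemma toggle_op_square: "toggle_op d i (toggle_op d i f) S = d i * f S"
proof -
  define p :: 'a where "p = (\<Prod>j<i. if j \<in> S then - 1 else 1)"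
  have "p * p = 1"
    unfolding p_def prod.distrib[symmetric] by (intro prod.neutral) auto
  moreover have "toggle_op d i (toggle_op d i f) S = (p * p) *
      ((if i \<in> S then d i else 1) * (if i \<in> toggle i S then d i else 1)) * f S"
    by (simp only: toggle_op_def toggle_sign toggle_toggle less_irrefl if_False mult_1 p_def mult.assoc
        mult.left_commute)
  ultimately show ?thesis by (simp add: toggle_def)
qed

text \<open>Toggling one index alters the sign attached to the other exactly when it is the smaller
  one. Of the two orders exactly one therefore picks up an extra sign.\<close>

lemma toggle_op_anticommute:
  "i \<noteq> j \<Longrightarrow> toggle_op d i (toggle_op d j f) S = - toggle_op d j (toggle_op d i f) S"
  by (simp add: toggle_op_def toggle_sign toggle_toggle(2)[of i j])
     (auto simp: toggle_def)

context regular_space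
begin

text \<open>In coordinates of an orthogonal basis a vector acts as a combination of toggle operators
  whose square is multiplication by \<open>q v\<close>. The ideal thus acts as zero, while a scalar
  \<open>c\<close> acts as multiplication by \<open>c\<close>.\<close>

lemma scalar_not_in_clifford_ideal:
  assumes "tensor_scalar c \<in> I"
  shows "c = 0"
proof -
  obtain e N where e: "orthogonal_family e N"
    and basis: "\<And>v. v = (\<Sum>i<N. (B v (e i) / (2 * q (e i))) *s e i)"
    using orthogonal_basis_exists by blast
  define x where "x = (\<lambda>v i. B v (e i) / (2 * q (e i)))"
  define g where "g = (\<lambda>v f S. \<Sum>i<N. x v i * toggle_op (\<lambda>i. q (e i)) i f S)"
  let ?E = "toggle_op (\<lambda>i. q (e i))"
  have E_lin: "?E i (\<lambda>S. a * f S + b * h S) S = a * ?E i f S + b * ?E i h S" for i a b f h S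
    by (simp add: toggle_op_def algebra_simps)
  have E_sum: "?E i (\<lambda>S. \<Sum>j\<in>A. y j * f j S) S = (\<Sum>j\<in>A. y j * ?E i (f j) S)" for i f S A and y :: "nat \<Rightarrow> 'a"
    by (simp add: toggle_op_def sum_distrib_left sum_distrib_right algebra_simps)
  \<comment> \<open>The letters are the standard basis vectors, whereas \<open>g\<close> is written
    in orthogonal coordinates; linearity of the coordinates reconciles the two for arbitrary
    vectors.\<close>
  define a where "a = (\<lambda>i::'n. g (axis i 1))"
  have lin: "linear_operator (a i)" for i
    by (simp add: linear_operator_def a_def g_def E_lin sum.distrib sum_distrib_left algebra_simps)
  have x_lin: "(\<Sum>i\<in>UNIV. v $ i * x (axis i 1) k) = x v k" for v k
  proof -
    have "B v (e k) = (\<Sum>i\<in>UNIV. v $ i * B (axis i 1) (e k))"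
      by (subst basis_expansion[of v, symmetric]) (simp add: polar_sum_left polar_smult_left)
    then show ?thesis by (simp add: x_def sum_divide_distrib)
  qed
  have act: "tensor_action a (tensor_vec v) f = g v f" for v f
  proof
    fix s
    have "tensor_action a (tensor_vec v) f s = (\<Sum>i\<in>UNIV. \<Sum>k<N. v $ i * x (axis i 1) k * ?E k f s)"
      by (simp add: tensor_action_vec a_def g_def sum_distrib_left algebra_simps)
    also have "\<dots> = (\<Sum>k<N. (\<Sum>i\<in>UNIV. v $ i * x (axis i 1) k) * ?E k f s)"
      by (subst sum.swap) (simp add: sum_distrib_right)
    finally show "tensor_action a (tensor_vec v) f s = g v f s"
      by (simp add: x_lin g_def)
  qed
  have x_polar: "B v (e i) = x v i * (2 * q (e i))" if "i < N" for v i
    using that e two by (simp add: x_def orthogonal_family_def)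
  have q_expand: "q v = (\<Sum>i<N. x v i * x v i * q (e i))" for v
  proof -
    have "2 * q v = B v v" by (simp add: polar_self)
    also have "\<dots> = B (\<Sum>i<N. x v i *s e i) v" using basis[of v] by (simp add: x_def)
    also have "\<dots> = (\<Sum>i<N. x v i * B v (e i))"
      by (simp add: polar_sum_left polar_smult_left polar_sym[of v])
    also have "\<dots> = 2 * (\<Sum>i<N. x v i * x v i * q (e i))"
      unfolding sum_distrib_left
      by (intro sum.cong) (simp_all add: x_polar)
    finally show ?thesis using two by simp
  qed
  have square: "g v (g v f) S = q v * f S" for v f S
  proof -
    let ?t = "\<lambda>i j. x v i * x v j * ?E i (?E j f) S"
    have "g v (g v f) S = (\<Sum>i<N. \<Sum>j<N. ?t i j)"
      by (simp add: g_def E_sum sum_distrib_left algebra_simps)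
    \<comment> \<open>Adding the transposed double sum pairs each off-diagonal term with its
      negative, and the diagonal contributes twice the expansion of \<open>q v\<close>.\<close>
    then have "2 * g v (g v f) S = (\<Sum>i<N. \<Sum>j<N. ?t i j) + (\<Sum>i<N. \<Sum>j<N. ?t j i)"
      using sum.swap[of "\<lambda>i j. ?t i j" "{..<N}" "{..<N}"] by simp
    also have "\<dots> = (\<Sum>i<N. \<Sum>j<N. ?t i j + ?t j i)" by (simp add: sum.distrib)
    also have "\<dots> = (\<Sum>i<N. \<Sum>j<N. if i = j then 2 * (x v i * x v i * q (e i) * f S) else 0)"
    proof (intro sum.cong refl)
      fix i j
      show "?t i j + ?t j i = (if i = j then 2 * (x v i * x v i * q (e i) * f S) else 0)"
        using toggle_op_anticommute[of i j "\<lambda>i. q (e i)" f S]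
        by (cases "i = j") (simp_all add: toggle_op_square algebra_simps)
    qed
    also have "\<dots> = 2 * (q v * f S)"
      by (simp add: q_expand[of v] sum_distrib_left sum_distrib_right)
    finally show ?thesis using two by simp
  qed
  have zero: "tensor_action a 0 f = (\<lambda>s. 0)" for f by (simp add: tensor_action_def)
  have "I \<subseteq> {p. \<forall>f. tensor_action a p f = (\<lambda>s. 0)}"
  proof (rule clifford_ideal_minimal, rule ideal_ring_of_type_algebraI)
    fix p p' assume p: "p \<in> {p. \<forall>f. tensor_action a p f = (\<lambda>s. 0)}"
    have "tensor_action a p' (\<lambda>s. 0) = (\<lambda>s. 0)"
      using linear_operatorD(3)[OF linear_operator_tensor_action[of a, OF lin]] by blast
    with p show "p' * p \<in> {p. \<forall>f. tensor_action a p f = (\<lambda>s. 0)}"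
      "p * p' \<in> {p. \<forall>f. tensor_action a p f = (\<lambda>s. 0)}"
      by (simp_all add: tensor_action_mult[of a, OF lin])
  qed (auto simp: zero fun_eq_iff tensor_action_add tensor_action_uminus tensor_action_diff
        tensor_action_mult[of a, OF lin] tensor_action_scalar act square)
  with assms have "tensor_action a (tensor_scalar c) (\<lambda>s. 1) {} = 0" by (force simp: fun_eq_iff)
  then show ?thesis by (simp add: tensor_action_scalar)
qed

end

section \<open>The twisted center\<close>

context regular_space
begin

abbreviation deg_sign where "deg_sign b \<equiv> (if b then - 1 else 1 :: 'a)"

lemma tensor_scalar_left_commute:
  "a * (tensor_scalar c * b) = tensor_scalar c * (a * b)" for a b :: "('a, 'n) tensor"
  by (metis mult.assoc tensor_scalar_commute)

lemma homogeneous_disjoint: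
  assumes "a \<in> tensor_part b" "a' \<in> tensor_part (\<not> b)" "cl a = cl a'"
  shows "cl a = cl 0"
  using assms cl_homogeneous_disjoint[of a a'] cl_homogeneous_disjoint[of a' a] by (cases b) auto

text \<open>Tensors built from \<open>e k\<close> up to \<open>e (N - 1)\<close> only, in any order
  and with repetition. Raising \<open>k\<close> discards one basis vector, and at
  \<open>k = N\<close> only scalars remain.\<close>

inductive basis_tensor :: "(nat \<Rightarrow> 'a ^ 'n) \<Rightarrow> nat \<Rightarrow> nat \<Rightarrow> bool \<Rightarrow> ('a, 'n) tensor \<Rightarrow> bool"
  for e N k where
  scalar: "basis_tensor e N k False (tensor_scalar c)"
| zero: "basis_tensor e N k b 0"
| add: "basis_tensor e N k b a \<Longrightarrow> basis_tensor e N k b a' \<Longrightarrow> basis_tensor e N k b (a + a')"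
| vec: "basis_tensor e N k b a \<Longrightarrow> k \<le> j \<Longrightarrow> j < N \<Longrightarrow>
    basis_tensor e N k (\<not> b) (tensor_vec (e j) * a)"

lemma basis_tensor_part: "basis_tensor e N k b a \<Longrightarrow> a \<in> tensor_part b"
proof (induction rule: basis_tensor.induct)
  case (vec b a j)
  then show ?case using tensor_part_mult[OF tensor_part_vec[of "e j"] vec.IH] by simp
qed (auto intro: tensor_part_scalar tensor_part_zero tensor_part_add)

lemma basis_tensor_smult: "basis_tensor e N k b a \<Longrightarrow> basis_tensor e N k b (tensor_scalar c * a)"
proof (induction rule: basis_tensor.induct)
  case (scalar d)
  then show ?case using basis_tensor.scalar[of e N k "c * d"] by (simp add: tensor_scalar_hom)
next
  case (vec b a j)
  have "tensor_scalar c * (tensor_vec (e j) * a) = tensor_vec (e j) * (tensor_scalar c * a)"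
    by (metis mult.assoc tensor_scalar_commute)
  with vec show ?case by (simp add: basis_tensor.vec)
qed (auto simp: distrib_left intro: basis_tensor.intros)

lemma cl_vec_anticommute:
  assumes "B v w = 0"
  shows "cl (tensor_vec v * (tensor_vec w * a)) = cl (- (tensor_vec w * (tensor_vec v * a)))"
  using cl_cong_mult[OF cl_vec_polar[of v w] refl[of "cl a"]] assms
  by (simp add: tensor_scalar_hom mult.assoc)

text \<open>\<open>e i\<close> is orthogonal to every vector occurring in \<open>a\<close>, so it
  passes each of them with a sign; the total depends only on the parity.\<close>

lemma basis_tensor_anticommute:
  assumes "basis_tensor e N k b a" "orthogonal_family e N" "i < k" "i < N"
  shows "cl (tensor_vec (e i) * a) = cl (tensor_scalar (deg_sign b) * (a * tensor_vec (e i)))"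
  using assms(1)
proof (induction rule: basis_tensor.induct)
  case (scalar c)
  then show ?case by (simp add: tensor_scalar_hom tensor_scalar_commute)
next
  case (add b a a')
  then show ?case using cl_cong_add[OF add.IH] by (simp only: distrib_left distrib_right)
next
  case (vec b a j)
  have "B (e i) (e j) = 0"
    using assms(2-4) vec.hyps by (simp add: orthogonal_family_def)
  then have "cl (tensor_vec (e i) * (tensor_vec (e j) * a)) = cl (- (tensor_vec (e j) * (tensor_vec (e i) * a)))"
    by (rule cl_vec_anticommute)
  also have "\<dots> = cl (- (tensor_vec (e j) * (tensor_scalar (deg_sign b) * (a * tensor_vec (e i)))))"
    by (intro cl_cong_uminus cl_cong_mult refl vec.IH)
  also have "- (tensor_vec (e j) * (tensor_scalar (deg_sign b) * (a * tensor_vec (e i)))) =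
      tensor_scalar (deg_sign (\<not> b)) * (tensor_vec (e j) * a * tensor_vec (e i))"
    by (simp add: tensor_scalar_hom mult.assoc)
  finally show ?case .
qed simp

text \<open>Each occurrence of \<open>e k\<close> can be moved to the front at the cost of a sign,
  and two occurrences collapse to the scalar \<open>q (e k)\<close>, so at most one
  survives.\<close>

lemma basis_tensor_split:
  assumes "basis_tensor e N k b a" "orthogonal_family e N" "k < N"
  shows "\<exists>a' b'. basis_tensor e N (Suc k) b a' \<and> basis_tensor e N (Suc k) (\<not> b) b' \<and>
    cl a = cl (a' + tensor_vec (e k) * b')"
  using assms(1)
proof (induction rule: basis_tensor.induct)
  case (scalar c)
  show ?case
    by (rule exI[of _ "tensor_scalar c"], rule exI[of _ 0]) (auto intro: basis_tensor.intros)
next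
  case (zero b)
  show ?case by (rule exI[of _ 0], rule exI[of _ 0]) (auto intro: basis_tensor.intros)
next
  case (add b a1 a2)
  then obtain a1' b1' a2' b2' where *:
    "basis_tensor e N (Suc k) b a1'" "basis_tensor e N (Suc k) (\<not> b) b1'"
    "cl a1 = cl (a1' + tensor_vec (e k) * b1')"
    "basis_tensor e N (Suc k) b a2'" "basis_tensor e N (Suc k) (\<not> b) b2'"
    "cl a2 = cl (a2' + tensor_vec (e k) * b2')" by blast
  show ?case
    using * cl_cong_add[OF *(3) *(6)]
    by (intro exI[of _ "a1' + a2'"] exI[of _ "b1' + b2'"])
      (auto intro: basis_tensor.intros simp: algebra_simps)
next
  case (vec b a j)
  then obtain a' b' where *: "basis_tensor e N (Suc k) b a'" "basis_tensor e N (Suc k) (\<not> b) b'"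
    and eq: "cl a = cl (a' + tensor_vec (e k) * b')" by blast
  have ea: "cl (tensor_vec (e j) * a) = cl (tensor_vec (e j) * (a' + tensor_vec (e k) * b'))"
    by (intro cl_cong_mult refl eq)
  show ?case
  proof (cases "j = k")
    case True
    \<comment> \<open>A further factor \<open>e k\<close> exchanges the roles of the two
      components.\<close>
    have "cl (tensor_vec (e k) * tensor_vec (e k) * b') = cl (tensor_scalar (q (e k)) * b')"
      by (intro cl_cong_mult refl cl_vec_square)
    then have "cl (tensor_vec (e k) * a' + tensor_vec (e k) * tensor_vec (e k) * b') =
        cl (tensor_vec (e k) * a' + tensor_scalar (q (e k)) * b')"
      by (intro cl_cong_add refl)
    moreover have "tensor_vec (e k) * (a' + tensor_vec (e k) * b') =
        tensor_vec (e k) * a' + tensor_vec (e k) * tensor_vec (e k) * b'"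
      by (simp add: distrib_left mult.assoc)
    ultimately have t: "cl (tensor_vec (e k) * a) = cl (tensor_scalar (q (e k)) * b' + tensor_vec (e k) * a')"
      using ea unfolding True by (metis add.commute)
    show ?thesis unfolding True
    proof (intro exI conjI)
      show "cl (tensor_vec (e k) * a) = cl (tensor_scalar (q (e k)) * b' + tensor_vec (e k) * a')"
        by (rule t)
    qed (use * in \<open>auto intro: basis_tensor_smult\<close>)
  next
    case False
    have "B (e j) (e k) = 0"
      using assms(2,3) vec.hyps False by (simp add: orthogonal_family_def)
    then have "cl (tensor_vec (e j) * (tensor_vec (e k) * b')) = cl (- (tensor_vec (e k) * (tensor_vec (e j) * b')))"
      by (rule cl_vec_anticommute)
    then have "cl (tensor_vec (e j) * a' + tensor_vec (e j) * (tensor_vec (e k) * b')) =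
        cl (tensor_vec (e j) * a' + - (tensor_vec (e k) * (tensor_vec (e j) * b')))"
      by (intro cl_cong_add refl)
    moreover have "tensor_vec (e j) * (a' + tensor_vec (e k) * b') =
        tensor_vec (e j) * a' + tensor_vec (e j) * (tensor_vec (e k) * b')"
      by (simp add: distrib_left)
    moreover have "- (tensor_vec (e k) * (tensor_vec (e j) * b')) =
        tensor_vec (e k) * (tensor_scalar (- 1) * (tensor_vec (e j) * b'))"
      by (simp add: tensor_scalar_hom)
    ultimately have "cl (tensor_vec (e j) * a) =
        cl (tensor_vec (e j) * a' + tensor_vec (e k) * (tensor_scalar (- 1) * (tensor_vec (e j) * b')))"
      using ea by metis
    moreover have "basis_tensor e N (Suc k) (\<not> b) (tensor_vec (e j) * a')"
      "basis_tensor e N (Suc k) (\<not> \<not> b) (tensor_scalar (- 1) * (tensor_vec (e j) * b'))"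
      using * False vec.hyps by (auto intro!: basis_tensor.vec basis_tensor_smult simp del: not_not)
    ultimately show ?thesis by blast
  qed
qed

text \<open>Expanding vectors in the orthogonal basis gives an even and an odd part; the part of the
  wrong parity vanishes in the quotient.\<close>

lemma homogeneous_basis_tensor:
  assumes "orthogonal_family e N"
    and basis: "\<And>v. v = (\<Sum>i<N. (B v (e i) / (2 * q (e i))) *s e i)"
    and p: "p \<in> tensor_part b"
  shows "\<exists>a. basis_tensor e N 0 b a \<and> cl p = cl a"
proof -
  have vec_mult: "basis_tensor e N 0 (\<not> b) (tensor_vec v * a)" if "basis_tensor e N 0 b a" for v a b
  proof -
    have "basis_tensor e N 0 (\<not> b) (\<Sum>i\<in>A. tensor_scalar (x i) * (tensor_vec (e i) * a))"
      if "A \<subseteq> {..<N}" for A and x :: "nat \<Rightarrow> 'a"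
      using finite_subset[OF that finite_lessThan] that
    proof (induction A rule: finite_induct)
      case (insert i A)
      then show ?case
        using \<open>basis_tensor e N 0 b a\<close> by (auto intro!: basis_tensor.add basis_tensor_smult basis_tensor.vec)
    qed (simp add: basis_tensor.zero)
    moreover have "tensor_vec v * a = (\<Sum>i<N. tensor_scalar (B v (e i) / (2 * q (e i))) * (tensor_vec (e i) * a))"
      by (subst basis[of v])
        (simp add: tensor_vec_sum tensor_vec_smult sum_distrib_right mult.assoc)
    ultimately show ?thesis by simp
  qed
  have "\<exists>a a'. basis_tensor e N 0 False a \<and> basis_tensor e N 0 True a' \<and> cl p = cl (a + a')" for p
  proof (induction p rule: tensor_span_induct)
    case (scalar c)
    show ?case
      by (rule exI[of _ "tensor_scalar c"], rule exI[of _ 0]) (auto intro: basis_tensor.intros)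
  next
    case (vec v p)
    then obtain a a' where *: "basis_tensor e N 0 False a" "basis_tensor e N 0 True a'"
      "cl p = cl (a + a')" by blast
    have "cl (tensor_vec v * p) = cl (tensor_vec v * a' + tensor_vec v * a)"
      using cl_cong_mult[OF refl[of "cl (tensor_vec v)"] *(3)] by (simp add: algebra_simps)
    then show ?case using vec_mult[OF *(1)] vec_mult[OF *(2)] by fastforce
  next
    case (add p p')
    then obtain a a' b b' where *: "basis_tensor e N 0 False a" "basis_tensor e N 0 True a'"
      "cl p = cl (a + a')" "basis_tensor e N 0 False b" "basis_tensor e N 0 True b'"
      "cl p' = cl (b + b')" by blast
    show ?case
      using * cl_cong_add[OF *(3) *(6)]
      by (intro exI[of _ "a + b"] exI[of _ "a' + b'"]) (auto intro: basis_tensor.add simp: algebra_simps)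
  qed
  then obtain a a' where *: "basis_tensor e N 0 b a" "basis_tensor e N 0 (\<not> b) a'" "cl p = cl (a + a')"
    by (cases b) (fastforce simp: add.commute)+
  have "cl (p + - a) = cl (a + a' + - a)" by (intro cl_cong_add refl *(3))
  then have pa: "cl (p + - a) = cl a'" by simp
  \<comment> \<open>\<open>p - a\<close> has parity \<open>b\<close> but is congruent to
    \<open>a'\<close>, which has the opposite parity.\<close>
  have "cl (p + - a) = cl 0"
    by (rule homogeneous_disjoint[OF _ basis_tensor_part[OF *(2)] pa])
      (intro tensor_part_add p tensor_part_uminus basis_tensor_part[OF *(1)])
  then have "cl (p + - a + a) = cl (0 + a)" by (intro cl_cong_add refl)
  with *(1) show ?thesis by auto
qed

text \<open>Removing the basis vectors one at a time: if \<open>a + e\<^sub>k b\<close> twisted-commutes with \<open>e\<^sub>k\<close>, where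
  \<open>a\<close> and \<open>b\<close> do not involve \<open>e\<^sub>k\<close>, then \<open>2 q(e\<^sub>k) b = 0\<close>.\<close>

lemma twisted_center:
  assumes p: "p \<in> tensor_part b"
    and comm: "\<And>u. cl (tensor_vec u * p) = cl (tensor_scalar (deg_sign b) * (p * tensor_vec u))"
  shows "\<exists>c. cl p = cl (tensor_scalar c)"
proof -
  obtain e N where e: "orthogonal_family e N"
    and basis: "\<And>v. v = (\<Sum>i<N. (B v (e i) / (2 * q (e i))) *s e i)"
    using orthogonal_basis_exists by blast
  have elim: "\<exists>c. cl p = cl (tensor_scalar c)" if "k \<le> N" "\<exists>a. basis_tensor e N k b a \<and> cl p = cl a" for k
    using that
  proof (induction k rule: inc_induct)
    case base
    then obtain a where "basis_tensor e N N b a" "cl p = cl a" by blast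
    moreover have "\<exists>c. a = tensor_scalar c" if "basis_tensor e N N b a" for a
      using that by (induction rule: basis_tensor.induct) (auto, (metis tensor_scalar_hom(1,3))+)
    ultimately show ?case by blast
  next
    case (step k)
    then obtain a0 where "basis_tensor e N k b a0" "cl p = cl a0" by blast
    then obtain a b' where ab: "basis_tensor e N (Suc k) b a" "basis_tensor e N (Suc k) (\<not> b) b'"
      and eq: "cl p = cl (a + tensor_vec (e k) * b')"
      using basis_tensor_split[OF _ e \<open>k < N\<close>] by metis
    let ?e = "tensor_vec (e k)" and ?q = "tensor_scalar (q (e k))"
    have sq: "cl (?e * ?e) = cl ?q" by (rule cl_vec_square)
    have s1: "tensor_scalar (deg_sign b) * tensor_scalar (deg_sign b) = 1" by (simp add: tensor_scalar_hom)
    have a_comm: "cl (?e * a) = cl (tensor_scalar (deg_sign b) * (a * ?e))"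
      using basis_tensor_anticommute[OF ab(1) e] \<open>k < N\<close> by simp
    have b_comm: "cl (tensor_scalar (deg_sign b) * (b' * ?e)) = cl (- (?e * b'))"
    proof -
      have "tensor_scalar (deg_sign (\<not> b)) * (b' * ?e) = - (tensor_scalar (deg_sign b) * (b' * ?e))"
        by (simp add: tensor_scalar_hom)
      then have "cl (?e * b') = cl (- (tensor_scalar (deg_sign b) * (b' * ?e)))"
        using basis_tensor_anticommute[OF ab(2) e, of k] \<open>k < N\<close> by simp
      from cl_cong_uminus[OF this] show ?thesis by simp
    qed
    \<comment> \<open>The product of \<open>e k\<close> with \<open>p\<close> is computed directly
      and through the commutation hypothesis; the two results differ only in the sign of the term
      with \<open>b'\<close>.\<close>
    have "cl (?e * a + ?q * b') = cl (?e * a + ?e * ?e * b')"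
      by (intro cl_cong_add refl cl_cong_mult sq[symmetric])
    also have "\<dots> = cl (?e * (a + ?e * b'))" by (simp add: distrib_left mult.assoc)
    also have "\<dots> = cl (?e * p)" by (intro cl_cong_mult refl eq[symmetric])
    also have "\<dots> = cl (tensor_scalar (deg_sign b) * (p * ?e))" by (rule comm)
    also have "\<dots> = cl (tensor_scalar (deg_sign b) * ((a + ?e * b') * ?e))"
      by (intro cl_cong_mult refl eq)
    also have "tensor_scalar (deg_sign b) * ((a + ?e * b') * ?e) =
        tensor_scalar (deg_sign b) * (a * ?e) + ?e * (tensor_scalar (deg_sign b) * (b' * ?e))"
      by (simp only: distrib_left distrib_right mult.assoc tensor_scalar_left_commute)
    also have "cl \<dots> = cl (?e * a + ?e * (- (?e * b')))"
      by (intro cl_cong_add cl_cong_mult refl a_comm[symmetric] b_comm)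
    also have "?e * a + ?e * (- (?e * b')) = ?e * a + - (?e * ?e * b')" by (simp add: mult.assoc)
    also have "cl \<dots> = cl (?e * a + - (?q * b'))"
      by (intro cl_cong_add cl_cong_uminus cl_cong_mult refl sq)
    finally have "cl (?e * a + ?q * b') = cl (?e * a + - (?q * b'))" .
    from cl_cong_add[OF refl[of "cl (- (?e * a) + ?q * b')"] this]
    have "cl (- (?e * a) + ?q * b' + (?e * a + ?q * b')) = cl (- (?e * a) + ?q * b' + (?e * a + - (?q * b')))" .
    moreover have "- (?e * a) + ?q * b' + (?e * a + ?q * b') = ?q * b' + ?q * b'"
      "- (?e * a) + ?q * b' + (?e * a + - (?q * b')) = 0" by simp_all
    ultimately have "cl (?q * b' + ?q * b') = cl 0" by metis
    moreover have "?q * b' + ?q * b' = tensor_scalar (q (e k) + q (e k)) * b'"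
      by (simp only: tensor_scalar_hom distrib_right)
    moreover have "q (e k) + q (e k) \<noteq> 0"
      using e \<open>k < N\<close> two by (simp add: orthogonal_family_def flip: mult_2)
    ultimately have "cl b' = cl 0" using cl_scalar_mult_eq_zero by metis
    then have "cl (a + ?e * b') = cl (a + ?e * 0)" by (intro cl_cong_add cl_cong_mult refl)
    with eq ab(1) have "\<exists>a. basis_tensor e N (Suc k) b a \<and> cl p = cl a" by auto
    then show ?case by (rule step.IH)
  qed
  show ?thesis by (rule elim[of 0]) (simp_all add: homogeneous_basis_tensor[OF e basis p])
qed

end

section \<open>The Clifford group\<close>

context regular_space
begin

section \<open>Scalars, vectors and degrees in the quotient\<close>

lemma sc_eq: "sc c = cl (tensor_scalar c)" and vec_eq: "vec v = cl (tensor_vec v)"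
  by (simp_all add: cl_scalar_def cl_vec_def)

lemma sc_closed [simp, intro]: "sc c \<in> carrier C" and vec_closed [simp, intro]: "vec v \<in> carrier C"
  by (simp_all add: sc_eq vec_eq)

lemma sc_one: "sc 1 = \<one>\<^bsub>C\<^esub>"
  by (simp add: sc_eq tensor_scalar_hom cl_one)

lemma sc_mult: "sc (a * b) = sc a \<otimes>\<^bsub>C\<^esub> sc b"
  by (simp add: sc_eq tensor_scalar_hom cl_mult)

lemma sc_commute: "x \<in> carrier C \<Longrightarrow> x \<otimes>\<^bsub>C\<^esub> sc c = sc c \<otimes>\<^bsub>C\<^esub> x"
  by (auto simp: carrier_C sc_eq tensor_scalar_commute simp flip: cl_mult)

lemma sc_left_commute:
  "x \<in> carrier C \<Longrightarrow> y \<in> carrier C \<Longrightarrow> x \<otimes>\<^bsub>C\<^esub> (sc c \<otimes>\<^bsub>C\<^esub> y) = sc c \<otimes>\<^bsub>C\<^esub> (x \<otimes>\<^bsub>C\<^esub> y)"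
  by (metis C.m_assoc sc_closed sc_commute)

lemma sc_sc_commute:
  "y \<in> carrier C \<Longrightarrow> sc a \<otimes>\<^bsub>C\<^esub> (sc b \<otimes>\<^bsub>C\<^esub> y) = sc b \<otimes>\<^bsub>C\<^esub> (sc a \<otimes>\<^bsub>C\<^esub> y)"
  by (rule sc_left_commute) auto

lemma sc_inj: "sc a = sc b \<Longrightarrow> a = b"
  using scalar_not_in_clifford_ideal[of "a - b"] by (simp add: sc_eq cl_eq_iff tensor_scalar_hom)

lemma vec_square: "vec v \<otimes>\<^bsub>C\<^esub> vec v = sc (q v)"
  using cl_vec_square[of v] by (simp add: sc_eq vec_eq cl_mult)

lemma vec_smult: "vec (c *s v) = sc c \<otimes>\<^bsub>C\<^esub> vec v"
  by (simp add: sc_eq vec_eq tensor_vec_smult cl_mult)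

lemma vec_add: "vec (v + w) = vec v \<oplus>\<^bsub>C\<^esub> vec w"
  by (simp add: vec_eq tensor_vec_add cl_add)

text \<open>The anticommutator of \<open>vec v\<close> with \<open>vec w\<close> is the scalar
  \<open>B v w\<close>. Scalars embed, so the class of \<open>v\<close> determines its polar
  pairings, hence \<open>v\<close> by regularity.\<close>

lemma vec_inj: "vec v = vec v' \<Longrightarrow> v = v'"
proof (rule polar_left_eqI)
  fix w assume eq: "vec v = vec v'"
  have polar: "sc (B v w) = vec v \<otimes>\<^bsub>C\<^esub> vec w \<oplus>\<^bsub>C\<^esub> vec w \<otimes>\<^bsub>C\<^esub> vec v" for v
    using cl_cong_add[OF cl_vec_polar[of v w] refl[of "cl (tensor_vec w * tensor_vec v)"]]
    by (simp add: sc_eq vec_eq cl_mult cl_add)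
  show "B v w = B v' w" by (rule sc_inj) (simp only: polar eq)
qed

lemma nontrivial: "\<one>\<^bsub>C\<^esub> \<noteq> cl 0"
  using sc_inj[of 1 0] by (auto simp: sc_one) (simp add: sc_eq tensor_scalar_hom)

definition part :: "bool \<Rightarrow> ('a, 'n) cliff set" where
  "part b = cl ` tensor_part b"

lemma cl_part_eq: "cl_part q 0 = part False" "cl_part q 1 = part True"
  by (simp_all add: cl_part_def part_def tensor_part_def even_iff_mod_2_eq_zero odd_iff_mod_2_eq_one)

lemma part_closed: "x \<in> part b \<Longrightarrow> x \<in> carrier C"
  by (auto simp: part_def)

lemma part_mult: "x \<in> part b \<Longrightarrow> y \<in> part b' \<Longrightarrow> x \<otimes>\<^bsub>C\<^esub> y \<in> part (b \<noteq> b')"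
  unfolding part_def by (clarify, unfold cl_mult[symmetric], intro imageI tensor_part_mult)

lemma part_sc: "sc c \<in> part False"
  by (simp add: part_def sc_eq tensor_part_scalar)

lemma part_vec: "vec v \<in> part True"
  by (simp add: part_def vec_eq tensor_part_vec)

text \<open>A class of both parities is zero, and a zero unit would make the algebra
  trivial.\<close>

lemma part_unique:
  assumes "x \<in> Units C" "x \<in> part b" "x \<in> part b'"
  shows "b = b'"
proof (rule ccontr)
  assume "b \<noteq> b'"
  then have b': "b' = (\<not> b)" by blast
  obtain a a' where a: "a \<in> tensor_part b" "a' \<in> tensor_part (\<not> b)" "x = cl a" "x = cl a'"
    using assms(2,3) unfolding part_def b' by blast
  have x: "x = cl 0" using homogeneous_disjoint[OF a(1,2)] a(3,4) by simp
  have "\<one>\<^bsub>C\<^esub> = x \<otimes>\<^bsub>C\<^esub> inv\<^bsub>C\<^esub> x" using assms(1) by simp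
  also obtain y where "inv\<^bsub>C\<^esub> x = cl y" using C.Units_inv_closed[OF assms(1)] by (auto simp: carrier_C)
  then have "x \<otimes>\<^bsub>C\<^esub> inv\<^bsub>C\<^esub> x = cl (0 * y)" by (simp only: cl_mult x)
  finally show False using nontrivial by (simp only: mult_zero_left)
qed

lemma cl_deg_part:
  assumes "x \<in> Units C" "x \<in> part b"
  shows "cl_deg q x = of_bool b"
  using part_unique[OF assms(1), of False True] assms by (cases b) (auto simp: cl_deg_def cl_part_eq(1))

lemma Units_r_cancel:
  assumes "z \<in> Units C" "x \<in> carrier C" "y \<in> carrier C" "x \<otimes>\<^bsub>C\<^esub> z = y \<otimes>\<^bsub>C\<^esub> z"
  shows "x = y"
proof -
  have "x \<otimes>\<^bsub>C\<^esub> (z \<otimes>\<^bsub>C\<^esub> inv\<^bsub>C\<^esub> z) = y \<otimes>\<^bsub>C\<^esub> (z \<otimes>\<^bsub>C\<^esub> inv\<^bsub>C\<^esub> z)"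
    by (metis assms C.Units_closed C.Units_inv_closed C.m_assoc)
  then show ?thesis using assms by simp
qed

lemma vec_Units_cancel:
  "x \<in> Units C \<Longrightarrow> vec v \<otimes>\<^bsub>C\<^esub> x = vec w \<otimes>\<^bsub>C\<^esub> x \<Longrightarrow> v = w"
  by (rule vec_inj, rule Units_r_cancel) auto

text \<open>\<open>implements x b f\<close>: \<open>x\<close> is homogeneous of degree \<open>b\<close> and \<open>r\<^sub>x = f\<close>, stated without \<open>x\<^sup>-\<^sup>1\<close>.\<close>

definition implements :: "('a, 'n) cliff \<Rightarrow> bool \<Rightarrow> ('a ^ 'n \<Rightarrow> 'a ^ 'n) \<Rightarrow> bool" where
  "implements x b f \<longleftrightarrow> x \<in> part b \<and> (\<forall>u. vec (f u) \<otimes>\<^bsub>C\<^esub> x = sc (deg_sign b) \<otimes>\<^bsub>C\<^esub> (x \<otimes>\<^bsub>C\<^esub> vec u))"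

lemma implementsD:
  assumes "implements x b f"
  shows "x \<in> part b" "x \<in> carrier C" "vec (f u) \<otimes>\<^bsub>C\<^esub> x = sc (deg_sign b) \<otimes>\<^bsub>C\<^esub> (x \<otimes>\<^bsub>C\<^esub> vec u)"
  using assms by (auto simp: implements_def part_closed)

lemma implements_sc: "implements (sc c) False (\<lambda>u. u)"
  by (simp add: implements_def part_sc sc_commute sc_one)

text \<open>From \<open>u z + z u = B u z\<close> and \<open>z z = q z\<close>, subtracting
  \<open>(B u z / q z) z\<close> from \<open>u\<close> and multiplying by \<open>z\<close> on the
  right leaves \<open>- z u\<close>.\<close>

lemma implements_vec:
  assumes "q z \<noteq> 0"
  shows "implements (vec z) True (reflection z)"
proof -
  have "cl (tensor_vec (reflection z u) * tensor_vec z) = cl (tensor_scalar (- 1) * (tensor_vec z * tensor_vec u))" for u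
  proof -
    let ?t = "tensor_scalar (- (B u z / q z)) :: ('a, 'n) tensor"
    have "tensor_vec (reflection z u) = tensor_vec u + ?t * tensor_vec z"
      unfolding reflection_def
      by (simp flip: tensor_vec_smult tensor_vec_add)
    then have "cl (tensor_vec (reflection z u) * tensor_vec z) =
        cl (tensor_vec u * tensor_vec z + ?t * (tensor_vec z * tensor_vec z))"
      by (simp add: distrib_right mult.assoc)
    also have "\<dots> = cl (tensor_scalar (B u z) - tensor_vec z * tensor_vec u + ?t * tensor_scalar (q z))"
      by (intro cl_cong_add cl_cong_mult refl cl_vec_square cl_vec_polar)
    also have "?t * tensor_scalar (q z) = - tensor_scalar (B u z)"
      using assms by (simp flip: tensor_scalar_hom(5,6))
    finally show ?thesis by (simp add: tensor_scalar_hom)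
  qed
  then show ?thesis by (simp add: implements_def part_vec) (simp add: sc_eq vec_eq cl_mult)
qed

lemma implements_mult:
  assumes x: "implements x b f" and y: "implements y b' g"
  shows "implements (x \<otimes>\<^bsub>C\<^esub> y) (b \<noteq> b') (\<lambda>u. f (g u))"
proof -
  note [simp] = implementsD(2)[OF x] implementsD(2)[OF y]
  have "vec (f (g u)) \<otimes>\<^bsub>C\<^esub> (x \<otimes>\<^bsub>C\<^esub> y) = sc (deg_sign (b \<noteq> b')) \<otimes>\<^bsub>C\<^esub> ((x \<otimes>\<^bsub>C\<^esub> y) \<otimes>\<^bsub>C\<^esub> vec u)" for u
  proof -
    have "vec (f (g u)) \<otimes>\<^bsub>C\<^esub> (x \<otimes>\<^bsub>C\<^esub> y) = (vec (f (g u)) \<otimes>\<^bsub>C\<^esub> x) \<otimes>\<^bsub>C\<^esub> y"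
      by (simp add: C.m_assoc)
    also have "\<dots> = sc (deg_sign b) \<otimes>\<^bsub>C\<^esub> (x \<otimes>\<^bsub>C\<^esub> (vec (g u) \<otimes>\<^bsub>C\<^esub> y))"
      by (simp only: implementsD(3)[OF x]) (simp add: C.m_assoc)
    also have "\<dots> = sc (deg_sign b) \<otimes>\<^bsub>C\<^esub> (sc (deg_sign b') \<otimes>\<^bsub>C\<^esub> (x \<otimes>\<^bsub>C\<^esub> (y \<otimes>\<^bsub>C\<^esub> vec u)))"
      by (simp only: implementsD(3)[OF y]) (simp add: sc_left_commute[OF implementsD(2)[OF x]])
    also have "\<dots> = sc (deg_sign b * deg_sign b') \<otimes>\<^bsub>C\<^esub> ((x \<otimes>\<^bsub>C\<^esub> y) \<otimes>\<^bsub>C\<^esub> vec u)"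
      by (simp add: sc_mult C.m_assoc)
    also have "deg_sign b * deg_sign b' = deg_sign (b \<noteq> b')" by simp
    finally show ?thesis .
  qed
  then show ?thesis
    using part_mult[OF implementsD(1)[OF x] implementsD(1)[OF y]] by (simp add: implements_def)
qed

lemma implements_unique:
  assumes u: "x \<in> Units C" and x: "implements x b f" "implements x b' g"
  shows "b = b'" "f = g"
proof -
  show b: "b = b'" using part_unique[OF u] x by (auto dest: implementsD)
  have "vec (f v) \<otimes>\<^bsub>C\<^esub> x = vec (g v) \<otimes>\<^bsub>C\<^esub> x" for v
    using implementsD(3)[OF x(1), of v] implementsD(3)[OF x(2), of v] b by (simp only:)
  then show "f = g" using vec_Units_cancel[OF u] by blast
qed

lemma implements_linear:
  assumes u: "x \<in> Units C" and x: "implements x b f"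
  shows "f (v + w) = f v + f w" "f (c *s v) = c *s f v"
proof -
  note [simp] = implementsD(2)[OF x]
  show "f (v + w) = f v + f w"
    by (rule vec_Units_cancel[OF u])
      (simp add: implementsD(3)[OF x] vec_add C.l_distr C.r_distr)
  show "f (c *s v) = c *s f v"
    by (rule vec_Units_cancel[OF u])
      (simp add: vec_smult C.m_assoc implementsD(3)[OF x] sc_left_commute[OF implementsD(2)[OF x]] sc_sc_commute)
qed

text \<open>Moving \<open>x\<close> leftwards past two copies of \<open>vec (f v)\<close> turns them
  into two copies of \<open>vec v\<close>. The degree sign enters squared, so the scalars
  \<open>q (f v)\<close> and \<open>q v\<close> agree after cancelling \<open>x\<close>.\<close>

lemma implements_isometry:
  assumes u: "x \<in> Units C" and x: "implements x b f"
  shows "q (f v) = q v" "B (f v) (f w) = B v w"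
proof -
  note [simp] = implementsD(2)[OF x]
  show q: "q (f v) = q v" for v
  proof -
    have "sc (q (f v)) \<otimes>\<^bsub>C\<^esub> x = vec (f v) \<otimes>\<^bsub>C\<^esub> (vec (f v) \<otimes>\<^bsub>C\<^esub> x)"
      by (simp add: C.m_assoc flip: vec_square)
    also have "\<dots> = vec (f v) \<otimes>\<^bsub>C\<^esub> (sc (deg_sign b) \<otimes>\<^bsub>C\<^esub> (x \<otimes>\<^bsub>C\<^esub> vec v))"
      by (simp only: implementsD(3)[OF x])
    also have "\<dots> = sc (deg_sign b) \<otimes>\<^bsub>C\<^esub> ((vec (f v) \<otimes>\<^bsub>C\<^esub> x) \<otimes>\<^bsub>C\<^esub> vec v)"
      by (simp add: C.m_assoc sc_left_commute[OF vec_closed])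
    also have "\<dots> = sc (deg_sign b * deg_sign b) \<otimes>\<^bsub>C\<^esub> (x \<otimes>\<^bsub>C\<^esub> (vec v \<otimes>\<^bsub>C\<^esub> vec v))"
      unfolding implementsD(3)[OF x, of v] sc_mult by (simp add: C.m_assoc)
    also have "\<dots> = sc (q v) \<otimes>\<^bsub>C\<^esub> x" by (simp add: vec_square sc_one sc_commute[OF implementsD(2)[OF x]])
    finally show ?thesis using Units_r_cancel[OF u _ _] sc_inj by auto
  qed
  show "B (f v) (f w) = B v w"
    using q_add[of "f v" "f w"] q_add[of v w] by (simp add: q flip: implements_linear(1)[OF u x])
qed

lemma implements_id_imp_scalar:
  assumes "implements x b (\<lambda>u. u)"
  shows "\<exists>c. x = sc c"
proof -
  obtain p where p: "p \<in> tensor_part b" "x = cl p"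
    using implementsD(1)[OF assms] by (auto simp: part_def)
  have "cl (tensor_vec u * p) = cl (tensor_scalar (deg_sign b) * (p * tensor_vec u))" for u
    using implementsD(3)[OF assms, of u] unfolding p(2) sc_eq vec_eq by (simp only: cl_mult)
  from twisted_center[OF p(1) this] show ?thesis by (auto simp: p(2) sc_eq)
qed

section \<open>Versors: scalar multiples of products of anisotropic vectors\<close>

inductive_set versors :: "('a, 'n) cliff set" where
  scalar: "c \<noteq> 0 \<Longrightarrow> sc c \<in> versors"
| vec: "x \<in> versors \<Longrightarrow> q v \<noteq> 0 \<Longrightarrow> vec v \<otimes>\<^bsub>C\<^esub> x \<in> versors"

lemma versor_closed: "x \<in> versors \<Longrightarrow> x \<in> carrier C"
  by (induction rule: versors.induct) auto

lemma versor_smult: "x \<in> versors \<Longrightarrow> c \<noteq> 0 \<Longrightarrow> sc c \<otimes>\<^bsub>C\<^esub> x \<in> versors"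
proof (induction rule: versors.induct)
  case (scalar d)
  then show ?case using versors.scalar[of "c * d"] by (simp add: sc_mult)
next
  case (vec x v)
  then show ?case using versors.vec[of "sc c \<otimes>\<^bsub>C\<^esub> x" v] by (simp add: sc_left_commute[OF vec_closed] versor_closed)
qed

lemma versor_mult: "x \<in> versors \<Longrightarrow> y \<in> versors \<Longrightarrow> x \<otimes>\<^bsub>C\<^esub> y \<in> versors"
  by (induction rule: versors.induct)
    (simp_all add: versor_smult C.m_assoc versor_closed versors.vec)

lemma versor_inv_exists:
  "x \<in> versors \<Longrightarrow> \<exists>y\<in>versors. x \<otimes>\<^bsub>C\<^esub> y = \<one>\<^bsub>C\<^esub> \<and> y \<otimes>\<^bsub>C\<^esub> x = \<one>\<^bsub>C\<^esub>"
proof (induction rule: versors.induct)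
  case (scalar c)
  then show ?case
    by (intro bexI[of _ "sc (1 / c)"]) (auto intro: versors.scalar simp: sc_one simp flip: sc_mult)
next
  case (vec x v)
  then obtain y where y: "y \<in> versors" "x \<otimes>\<^bsub>C\<^esub> y = \<one>\<^bsub>C\<^esub>" "y \<otimes>\<^bsub>C\<^esub> x = \<one>\<^bsub>C\<^esub>" by blast
  note [simp] = versor_closed[OF y(1)] versor_closed[OF vec.hyps(1)]
  \<comment> \<open>The inverse of an anisotropic vector is the vector divided by its value under
    \<open>q\<close>.\<close>
  define v' where "v' = vec v \<otimes>\<^bsub>C\<^esub> sc (1 / q v)"
  have v': "v' \<in> versors"
    unfolding v'_def using vec.hyps by (intro versors.vec versors.scalar) auto
  have [simp]: "v' \<in> carrier C" using v' versor_closed by blast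
  have inv: "vec v \<otimes>\<^bsub>C\<^esub> v' = \<one>\<^bsub>C\<^esub>" "v' \<otimes>\<^bsub>C\<^esub> vec v = \<one>\<^bsub>C\<^esub>"
    using vec.hyps by (simp_all add: v'_def sc_commute[OF vec_closed] C.m_assoc sc_left_commute[OF vec_closed] vec_square sc_one flip: sc_mult)
  show ?case
  proof (rule bexI[of _ "y \<otimes>\<^bsub>C\<^esub> v'"], rule conjI)
    have "(vec v \<otimes>\<^bsub>C\<^esub> x) \<otimes>\<^bsub>C\<^esub> (y \<otimes>\<^bsub>C\<^esub> v') = vec v \<otimes>\<^bsub>C\<^esub> ((x \<otimes>\<^bsub>C\<^esub> y) \<otimes>\<^bsub>C\<^esub> v')"
      by (simp add: C.m_assoc)
    then show "(vec v \<otimes>\<^bsub>C\<^esub> x) \<otimes>\<^bsub>C\<^esub> (y \<otimes>\<^bsub>C\<^esub> v') = \<one>\<^bsub>C\<^esub>" by (simp add: y inv)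
    have "(y \<otimes>\<^bsub>C\<^esub> v') \<otimes>\<^bsub>C\<^esub> (vec v \<otimes>\<^bsub>C\<^esub> x) = y \<otimes>\<^bsub>C\<^esub> ((v' \<otimes>\<^bsub>C\<^esub> vec v) \<otimes>\<^bsub>C\<^esub> x)"
      by (simp add: C.m_assoc)
    then show "(y \<otimes>\<^bsub>C\<^esub> v') \<otimes>\<^bsub>C\<^esub> (vec v \<otimes>\<^bsub>C\<^esub> x) = \<one>\<^bsub>C\<^esub>" by (simp add: y inv)
  qed (rule versor_mult[OF y(1) v'])
qed

lemma versor_Units: "x \<in> versors \<Longrightarrow> x \<in> Units C"
  using versor_inv_exists[of x] versor_closed unfolding Units_def by blast

lemma versor_inv: "x \<in> versors \<Longrightarrow> inv\<^bsub>C\<^esub> x \<in> versors"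
  using versor_inv_exists[of x] versor_closed C.inv_unique' by metis

lemma versor_implements: "x \<in> versors \<Longrightarrow> \<exists>b f. implements x b f"
  by (induction rule: versors.induct) (blast intro: implements_sc implements_mult implements_vec)+

text \<open>This is the surjectivity of \<open>r\<close>: each reflection in a product of
  reflections is implemented by its vector.\<close>

lemma isometry_versor:
  assumes "\<And>u v. B (f u) (f v) = B u v"
  shows "\<exists>x\<in>versors. \<exists>b. implements x b f"
  using assms
proof (induction f rule: isometry_induct)
  case id
  show ?case using versors.scalar[of 1] implements_sc by force
next
  case (reflection z f)
  then show ?case using implements_mult[OF implements_vec] versors.vec by blast
qed

lemma versor_conj:
  assumes "x \<in> versors"
  shows "\<exists>w. x \<otimes>\<^bsub>C\<^esub> vec u \<otimes>\<^bsub>C\<^esub> inv\<^bsub>C\<^esub> x = vec w"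
proof -
  note [simp] = versor_closed[OF assms] versor_Units[OF assms]
  obtain b f where x: "implements x b f" using versor_implements[OF assms] by blast
  have "x \<otimes>\<^bsub>C\<^esub> vec u = sc (deg_sign b) \<otimes>\<^bsub>C\<^esub> (vec (f u) \<otimes>\<^bsub>C\<^esub> x)"
    unfolding implementsD(3)[OF x] by (simp add: sc_one flip: C.m_assoc sc_mult)
  then have "x \<otimes>\<^bsub>C\<^esub> vec u \<otimes>\<^bsub>C\<^esub> inv\<^bsub>C\<^esub> x = vec (deg_sign b *s f u)"
    by (simp add: vec_smult C.m_assoc)
  then show ?thesis by blast
qed

text \<open>An element \<open>x\<close> of the Clifford group induces an isometry, which some versor
  \<open>y\<close> induces too. Then the inverse of \<open>y\<close> times \<open>x\<close>
  implements the identity and is a scalar.\<close>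

lemma carrier_clifford_group: "carrier (clifford_group q) = versors"
proof
  show "versors \<subseteq> carrier (clifford_group q)"
  proof
    fix x assume x: "x \<in> versors"
    note [simp] = versor_closed[OF x] versor_Units[OF x]
    obtain b f where "implements x b f" using versor_implements[OF x] by blast
    then have "x \<in> part False \<union> part True" by (cases b) (auto dest: implementsD)
    moreover have "(\<lambda>u. x \<otimes>\<^bsub>C\<^esub> u \<otimes>\<^bsub>C\<^esub> inv\<^bsub>C\<^esub> x) ` range vec = range vec"
    proof
      show "(\<lambda>u. x \<otimes>\<^bsub>C\<^esub> u \<otimes>\<^bsub>C\<^esub> inv\<^bsub>C\<^esub> x) ` range vec \<subseteq> range vec"
      proof clarify
        show "x \<otimes>\<^bsub>C\<^esub> vec u \<otimes>\<^bsub>C\<^esub> inv\<^bsub>C\<^esub> x \<in> range vec" for u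
          using versor_conj[OF x, of u] by auto
      qed
      show "range vec \<subseteq> (\<lambda>u. x \<otimes>\<^bsub>C\<^esub> u \<otimes>\<^bsub>C\<^esub> inv\<^bsub>C\<^esub> x) ` range vec"
      proof
        fix y assume "y \<in> range vec"
        then obtain u where y: "y = vec u" by blast
        \<comment> \<open>Surjectivity onto the vectors comes from conjugating by the inverse, which
          is a versor as well.\<close>
        obtain w where w: "inv\<^bsub>C\<^esub> x \<otimes>\<^bsub>C\<^esub> vec u \<otimes>\<^bsub>C\<^esub> inv\<^bsub>C\<^esub> (inv\<^bsub>C\<^esub> x) = vec w"
          using versor_conj[OF versor_inv[OF x]] by blast
        have "x \<otimes>\<^bsub>C\<^esub> vec w \<otimes>\<^bsub>C\<^esub> inv\<^bsub>C\<^esub> x = (x \<otimes>\<^bsub>C\<^esub> inv\<^bsub>C\<^esub> x) \<otimes>\<^bsub>C\<^esub> (vec u \<otimes>\<^bsub>C\<^esub> (x \<otimes>\<^bsub>C\<^esub> inv\<^bsub>C\<^esub> x))"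
          unfolding w[symmetric] by (simp add: C.m_assoc del: C.Units_r_inv)
        then have "y = x \<otimes>\<^bsub>C\<^esub> vec w \<otimes>\<^bsub>C\<^esub> inv\<^bsub>C\<^esub> x" by (simp add: y)
        then show "y \<in> (\<lambda>u. x \<otimes>\<^bsub>C\<^esub> u \<otimes>\<^bsub>C\<^esub> inv\<^bsub>C\<^esub> x) ` range vec" by blast
      qed
    qed
    ultimately show "x \<in> carrier (clifford_group q)"
      by (simp add: clifford_group_def Let_def cl_part_eq cl_part_eq(2)[unfolded One_nat_def])
  qed
  show "carrier (clifford_group q) \<subseteq> versors"
  proof
    fix x assume "x \<in> carrier (clifford_group q)"
    then have u [simp]: "x \<in> Units C" and "x \<in> cl_part q 0 \<union> cl_part q 1"
      and V: "(\<lambda>u. x \<otimes>\<^bsub>C\<^esub> u \<otimes>\<^bsub>C\<^esub> inv\<^bsub>C\<^esub> x) ` range vec = range vec"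
      by (auto simp: clifford_group_def Let_def)
    then obtain b where b: "x \<in> part b" unfolding cl_part_eq by blast
    have [simp]: "x \<in> carrier C" using b part_closed by blast
    have "\<exists>w. x \<otimes>\<^bsub>C\<^esub> vec u \<otimes>\<^bsub>C\<^esub> inv\<^bsub>C\<^esub> x = vec w" for u using V by blast
    then obtain g where g: "\<And>u. x \<otimes>\<^bsub>C\<^esub> vec u \<otimes>\<^bsub>C\<^esub> inv\<^bsub>C\<^esub> x = vec (g u)" by metis
    have "vec (deg_sign b *s g u) \<otimes>\<^bsub>C\<^esub> x = sc (deg_sign b) \<otimes>\<^bsub>C\<^esub> (x \<otimes>\<^bsub>C\<^esub> vec u)" for u
      unfolding vec_smult g[symmetric] by (simp add: C.m_assoc)
    \<comment> \<open>Conjugation itself is \<open>g\<close>; the degree sign converts it to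
      \<open>r\<close>.\<close>
    then have x: "implements x b (\<lambda>u. deg_sign b *s g u)" by (simp add: implements_def b)
    then obtain y b' where y: "y \<in> versors" and y': "implements y b' (\<lambda>u. deg_sign b *s g u)"
      using isometry_versor[of "\<lambda>u. deg_sign b *s g u"] implements_isometry(2)[OF u x] by blast
    obtain b'' f where f: "implements (inv\<^bsub>C\<^esub> y) b'' f"
      using versor_implements[OF versor_inv[OF y]] by blast
    \<comment> \<open>The unit element implements both this composite and the identity, so
      \<open>f\<close> undoes the isometry shared by \<open>x\<close> and \<open>y\<close>.\<close>
    have "implements \<one>\<^bsub>C\<^esub> (b'' \<noteq> b') (\<lambda>u. f (deg_sign b *s g u))"
      using implements_mult[OF f y'] versor_Units[OF y] by simp
    moreover have "implements \<one>\<^bsub>C\<^esub> False (\<lambda>u. u)"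
      using implements_sc[of 1] by (simp add: sc_one)
    ultimately have "(\<lambda>u. f (deg_sign b *s g u)) = (\<lambda>u. u)"
      by (rule implements_unique(2)[OF C.Units_one_closed])
    then have "implements (inv\<^bsub>C\<^esub> y \<otimes>\<^bsub>C\<^esub> x) (b'' \<noteq> b) (\<lambda>u. u)"
      using implements_mult[OF f x] by simp
    then obtain c where c: "inv\<^bsub>C\<^esub> y \<otimes>\<^bsub>C\<^esub> x = sc c" using implements_id_imp_scalar by blast
    have "y \<otimes>\<^bsub>C\<^esub> (inv\<^bsub>C\<^esub> y \<otimes>\<^bsub>C\<^esub> x) = x"
      using versor_Units[OF y] versor_closed[OF y] by (simp flip: C.m_assoc)
    then have xc: "x = sc c \<otimes>\<^bsub>C\<^esub> y" using c sc_commute[OF versor_closed[OF y]] by simp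
    have "c \<noteq> 0"
    proof
      assume "c = 0"
      then have "x = cl 0" using xc versor_closed[OF y]
        by (auto simp: sc_eq tensor_scalar_hom carrier_C simp flip: cl_mult)
      \<comment> \<open>Zero has both parities, which is impossible for a unit.\<close>
      then have "x \<in> part True" "x \<in> part False" by (auto simp: part_def tensor_part_zero)
      with part_unique[OF u] show False by blast
    qed
    with xc y show "x \<in> versors" by (simp add: versor_smult)
  qed
qed

section \<open>Group structure and the matrices of \<open>r\<close>\<close>

abbreviation CG where "CG \<equiv> clifford_group q"

lemma clifford_group_simps [simp]:
  "carrier CG = versors" "x \<otimes>\<^bsub>CG\<^esub> y = x \<otimes>\<^bsub>C\<^esub> y" "\<one>\<^bsub>CG\<^esub> = \<one>\<^bsub>C\<^esub>"
  by (rule carrier_clifford_group) (simp_all add: clifford_group_def Let_def)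

lemma versor_one: "\<one>\<^bsub>C\<^esub> \<in> versors"
  using versors.scalar[of 1] by (simp add: sc_one)

sublocale CG: group CG
proof (rule groupI)
  show "\<exists>y\<in>carrier CG. y \<otimes>\<^bsub>CG\<^esub> x = \<one>\<^bsub>CG\<^esub>" if "x \<in> carrier CG" for x
    using versor_inv_exists[of x] that by auto
qed (auto simp: versor_mult versor_one C.m_assoc versor_closed)

text \<open>The definite description in \<open>cl_rot\<close> has a solution because the implemented
  map is linear, and only one because vectors embed in the algebra.\<close>

lemma rot_implements:
  assumes x: "x \<in> versors"
  shows "\<exists>b. implements x b ((*v) (cl_rot q x))"
proof -
  note [simp] = versor_closed[OF x] versor_Units[OF x]
  obtain b f where f: "implements x b f" using versor_implements[OF x] by blast
  have "Vector_Spaces.linear (*s) (*s) f"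
    by (intro Vector_Spaces.linear.intro vec.vector_space_axioms module_hom.intro module_hom_axioms.intro
        vec.module_axioms implements_linear[OF _ f]) simp_all
  then have mf: "matrix f *v u = f u" for u by (rule matrix_works)
  have deg: "sc ((- 1) ^ cl_deg q x) = sc (deg_sign b)"
    using cl_deg_part[of x b] implementsD(1)[OF f] by (cases b) simp_all
  have r: "sc (deg_sign b) \<otimes>\<^bsub>C\<^esub> x \<otimes>\<^bsub>C\<^esub> vec u \<otimes>\<^bsub>C\<^esub> inv\<^bsub>C\<^esub> x = vec (f u)" for u
  proof -
    have "sc (deg_sign b) \<otimes>\<^bsub>C\<^esub> x \<otimes>\<^bsub>C\<^esub> vec u \<otimes>\<^bsub>C\<^esub> inv\<^bsub>C\<^esub> x = vec (f u) \<otimes>\<^bsub>C\<^esub> x \<otimes>\<^bsub>C\<^esub> inv\<^bsub>C\<^esub> x"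
      unfolding implementsD(3)[OF f] by (simp add: C.m_assoc)
    then show ?thesis by (simp add: C.m_assoc)
  qed
  have "cl_rot q x = matrix f"
    unfolding cl_rot_def
  proof (rule the_equality)
    show "\<forall>u. vec (matrix f *v u) = sc ((- 1) ^ cl_deg q x) \<otimes>\<^bsub>C\<^esub> x \<otimes>\<^bsub>C\<^esub> vec u \<otimes>\<^bsub>C\<^esub> inv\<^bsub>C\<^esub> x"
      unfolding deg r mf by simp
    fix A assume "\<forall>u. vec (A *v u) = sc ((- 1) ^ cl_deg q x) \<otimes>\<^bsub>C\<^esub> x \<otimes>\<^bsub>C\<^esub> vec u \<otimes>\<^bsub>C\<^esub> inv\<^bsub>C\<^esub> x"
    then have "A *v u = f u" for u unfolding deg r by (blast intro: vec_inj)
    then show "A = matrix f" by (simp add: matrix_eq mf)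
  qed
  then have "(*v) (cl_rot q x) = f" by (auto simp: mf)
  with f show ?thesis by blast
qed

lemma rot_eqI:
  assumes "x \<in> versors" "implements x b ((*v) A)"
  shows "cl_rot q x = A"
proof -
  obtain b' where "implements x b' ((*v) (cl_rot q x))" using rot_implements assms by blast
  then have "(*v) (cl_rot q x) = (*v) A"
    using implements_unique(2)[OF versor_Units _ assms(2)] assms(1) by blast
  then show ?thesis by (simp add: matrix_eq)
qed

lemma rot_mult:
  assumes x: "x \<in> versors" and y: "y \<in> versors"
  shows "cl_rot q (x \<otimes>\<^bsub>C\<^esub> y) = cl_rot q x ** cl_rot q y"
proof -
  obtain b b' where "implements x b ((*v) (cl_rot q x))" "implements y b' ((*v) (cl_rot q y))"
    using rot_implements x y by meson
  from implements_mult[OF this] show ?thesis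
    by (intro rot_eqI[OF versor_mult[OF x y]]) (simp add: matrix_vector_mul_assoc)
qed

lemma mat_one_apply: "(*v) (mat 1 :: 'a ^ 'n ^ 'n) = (\<lambda>u. u)"
  by (rule ext) simp

lemma rot_sc: "c \<noteq> 0 \<Longrightarrow> cl_rot q (sc c) = mat 1"
  using implements_sc[of c] by (intro rot_eqI[of _ False]) (simp_all add: versors.scalar mat_one_apply)

lemma rot_eq_one_imp_scalar:
  assumes "x \<in> versors" "cl_rot q x = mat 1"
  shows "\<exists>c. x = sc c"
  using rot_implements[OF assms(1)] implements_id_imp_scalar by (auto simp: assms(2) mat_one_apply)

lemma rot_surj:
  assumes "\<And>v. q (A *v v) = q v"
  shows "\<exists>x\<in>versors. cl_rot q x = A"
proof -
  have "B (A *v u) (A *v v) = B u v" for u v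
    using assms[of "u + v"] assms[of u] assms[of v] by (simp add: q_add matrix_vector_right_distrib)
  then obtain x b where "x \<in> versors" "implements x b ((*v) A)" using isometry_versor[of "(*v) A"] by blast
  with rot_eqI show ?thesis by blast
qed

section \<open>The norm\<close>

lemma involution_mult:
  "x \<in> carrier C \<Longrightarrow> y \<in> carrier C \<Longrightarrow>
    cl_involution (x \<otimes>\<^bsub>C\<^esub> y) = cl_involution y \<otimes>\<^bsub>C\<^esub> cl_involution x"
  by (auto simp: carrier_C cl_involution_cl tensor_rev_mult simp flip: cl_mult)

lemma involution_closed: "x \<in> carrier C \<Longrightarrow> cl_involution x \<in> carrier C"
  by (auto simp: carrier_C cl_involution_cl)

lemma involution_sc: "cl_involution (sc c) = sc c"
  by (simp add: sc_eq cl_involution_cl)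

lemma involution_vec: "cl_involution (vec v) = vec v"
  by (simp add: vec_eq cl_involution_cl)

lemma norm_sc: "cl_norm q (sc c) = sc (c\<^sup>2)"
  by (simp add: cl_norm_def involution_sc power2_eq_square sc_mult)

text \<open>The norm of a product is \<open>x\<close> times the norm of \<open>y\<close> times the
  involution of \<open>x\<close>; a scalar in the middle can be moved out.\<close>

lemma norm_mult_scalar:
  assumes x: "x \<in> carrier C" and y: "y \<in> carrier C" and N: "cl_norm q y = sc c"
  shows "cl_norm q (x \<otimes>\<^bsub>C\<^esub> y) = cl_norm q x \<otimes>\<^bsub>C\<^esub> sc c"
proof -
  note [simp] = x y involution_closed[OF x] involution_closed[OF y]
  have "cl_norm q (x \<otimes>\<^bsub>C\<^esub> y) = x \<otimes>\<^bsub>C\<^esub> (cl_norm q y \<otimes>\<^bsub>C\<^esub> cl_involution x)"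
    by (simp add: cl_norm_def involution_mult C.m_assoc)
  also have "\<dots> = cl_norm q x \<otimes>\<^bsub>C\<^esub> sc c"
    by (simp only: N) (simp add: cl_norm_def C.m_assoc sc_commute[OF involution_closed[OF x]])
  finally show ?thesis .
qed

lemma norm_versor: "x \<in> versors \<Longrightarrow> \<exists>c. c \<noteq> 0 \<and> cl_norm q x = sc c"
proof (induction rule: versors.induct)
  case (scalar c)
  then show ?case by (intro exI[of _ "c\<^sup>2"]) (simp add: norm_sc)
next
  case (vec x v)
  then obtain c where c: "c \<noteq> 0" "cl_norm q x = sc c" by blast
  have "cl_norm q (vec v \<otimes>\<^bsub>C\<^esub> x) = sc (q v * c)"
    using norm_mult_scalar[OF vec_closed versor_closed[OF vec.hyps(1)] c(2), of v]
    by (simp add: cl_norm_def[of q "vec v"] involution_vec vec_square sc_mult)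
  then show ?case using c(1) vec.hyps by (intro exI[of _ "q v * c"]) simp
qed

lemma norm_mult:
  assumes "x \<in> versors" "y \<in> versors" "cl_norm q x = sc c" "cl_norm q y = sc d"
  shows "cl_norm q (x \<otimes>\<^bsub>C\<^esub> y) = sc (c * d)"
  using norm_mult_scalar[OF _ _ assms(4)] assms(1-3) versor_closed by (simp add: sc_mult)

end

section \<open>Extensions attached to characters\<close>

text \<open>The setting over the large field; square roots are what the separable closure
  contributes to it.\<close>

locale orthogonal_representation = regular_space Q q + G: group G
  for Q :: "'a::field ^ 'n::finite ^ 'n" and q :: "'a ^ 'n \<Rightarrow> 'a" and G :: "'g monoid" +
  fixes \<rho> :: "'g \<Rightarrow> 'a ^ 'n ^ 'n"
  assumes rep: "\<rho> \<in> mon G (orthogonal_grp q)"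
    and sqrt_exists: "\<exists>y. y\<^sup>2 = (c::'a)"
begin

abbreviation r' where "r' \<equiv> rot_to q G \<rho>"
abbreviation j where "j \<equiv> (\<lambda>\<epsilon>::int. sc (of_int \<epsilon>))"

lemma rep_mult: "g \<in> carrier G \<Longrightarrow> h \<in> carrier G \<Longrightarrow> \<rho> (g \<otimes>\<^bsub>G\<^esub> h) = \<rho> g ** \<rho> h"
  and rep_isometry: "g \<in> carrier G \<Longrightarrow> q (\<rho> g *v v) = q v"
  and rep_inj: "g \<in> carrier G \<Longrightarrow> h \<in> carrier G \<Longrightarrow> \<rho> g = \<rho> h \<Longrightarrow> g = h"
  using rep by (auto simp: mon_def hom_def orthogonal_grp_def inj_on_def)

text \<open>An invertible idempotent matrix is the identity; this avoids showing first that the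
  orthogonal matrices form a group.\<close>

lemma rep_one: "\<rho> \<one>\<^bsub>G\<^esub> = mat 1"
proof -
  have "invertible (\<rho> \<one>\<^bsub>G\<^esub>)" using rep by (auto simp: mon_def hom_def orthogonal_grp_def)
  then obtain M where M: "\<rho> \<one>\<^bsub>G\<^esub> ** M = mat 1" by (auto simp: invertible_def)
  have "\<rho> \<one>\<^bsub>G\<^esub> ** \<rho> \<one>\<^bsub>G\<^esub> ** M = \<rho> \<one>\<^bsub>G\<^esub> ** M" by (simp flip: rep_mult)
  then show ?thesis by (simp add: M flip: matrix_mul_assoc)
qed

lemma rot_to_eqI: "g \<in> carrier G \<Longrightarrow> cl_rot q x = \<rho> g \<Longrightarrow> r' x = g"
  using rep_inj by (auto simp: rot_to_def inj_on_def intro: inv_into_f_f)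

section \<open>Characters of \<open>G\<close> and their extensions\<close>

definition character :: "('g \<Rightarrow> 'a) \<Rightarrow> bool" where
  "character \<psi> \<longleftrightarrow> (\<forall>g\<in>carrier G. \<psi> g \<noteq> 0) \<and>
     (\<forall>g\<in>carrier G. \<forall>h\<in>carrier G. \<psi> (g \<otimes>\<^bsub>G\<^esub> h) = \<psi> g * \<psi> h)"

lemma character_mult:
  "character \<psi> \<Longrightarrow> g \<in> carrier G \<Longrightarrow> h \<in> carrier G \<Longrightarrow> \<psi> (g \<otimes>\<^bsub>G\<^esub> h) = \<psi> g * \<psi> h"
  and character_nonzero: "character \<psi> \<Longrightarrow> g \<in> carrier G \<Longrightarrow> \<psi> g \<noteq> 0"
  by (auto simp: character_def)

lemma character_one: "character \<psi> \<Longrightarrow> \<psi> \<one>\<^bsub>G\<^esub> = 1"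
  using character_mult[of \<psi> "\<one>\<^bsub>G\<^esub>" "\<one>\<^bsub>G\<^esub>"] character_nonzero[of \<psi> "\<one>\<^bsub>G\<^esub>"] by simp

definition extension :: "('g \<Rightarrow> 'a) \<Rightarrow> ('a, 'n) cliff set" where
  "extension \<psi> = {x \<in> versors. cl_rot q x \<in> \<rho> ` carrier G \<and> cl_norm q x = sc (\<psi> (r' x))}"

lemma extensionI:
  "x \<in> versors \<Longrightarrow> g \<in> carrier G \<Longrightarrow> cl_rot q x = \<rho> g \<Longrightarrow> cl_norm q x = sc (\<psi> g) \<Longrightarrow> x \<in> extension \<psi>"
  by (auto simp: extension_def rot_to_eqI)

lemma extensionD:
  assumes "x \<in> extension \<psi>"
  shows "x \<in> versors" "r' x \<in> carrier G" "cl_rot q x = \<rho> (r' x)" "cl_norm q x = sc (\<psi> (r' x))"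
  using assms by (auto simp: extension_def rot_to_eqI)

lemma pin_preimage_eq: "pin_preimage q G \<rho> = extension (\<lambda>_. 1)"
  by (auto simp: pin_preimage_def extension_def Pin_def sc_one)

lemma extension_lift:
  assumes g: "g \<in> carrier G" and "character \<psi>"
  shows "\<exists>x\<in>extension \<psi>. r' x = g"
proof -
  obtain y where y: "y \<in> versors" "cl_rot q y = \<rho> g" using rot_surj rep_isometry[OF g] by blast
  obtain d where d: "d \<noteq> 0" "cl_norm q y = sc d" using norm_versor y by blast
  \<comment> \<open>Scaling by \<open>c\<close> multiplies the norm by the square of
    \<open>c\<close> and leaves \<open>r\<close> unchanged.\<close>
  obtain c where c: "c\<^sup>2 = \<psi> g / d" using sqrt_exists by blast
  have c0: "c \<noteq> 0" using c d character_nonzero assms by force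
  have "cl_norm q (sc c \<otimes>\<^bsub>C\<^esub> y) = sc (\<psi> g)"
    using norm_mult[OF versors.scalar[OF c0] y(1) norm_sc d(2)] c d by simp
  moreover have "cl_rot q (sc c \<otimes>\<^bsub>C\<^esub> y) = \<rho> g"
    using rot_mult[OF versors.scalar[OF c0] y(1)] by (simp add: rot_sc[OF c0] y)
  ultimately show ?thesis
    using y(1) c0 g by (intro bexI[of _ "sc c \<otimes>\<^bsub>C\<^esub> y"] extensionI rot_to_eqI versor_smult)
qed

lemma extension_mult:
  assumes "character \<psi>" "x \<in> extension \<psi>" "y \<in> extension \<psi>"
  shows "x \<otimes>\<^bsub>C\<^esub> y \<in> extension \<psi>" "r' (x \<otimes>\<^bsub>C\<^esub> y) = r' x \<otimes>\<^bsub>G\<^esub> r' y"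
proof -
  note D = extensionD[OF assms(2)] extensionD[OF assms(3)]
  have rot: "cl_rot q (x \<otimes>\<^bsub>C\<^esub> y) = \<rho> (r' x \<otimes>\<^bsub>G\<^esub> r' y)"
    using D by (simp add: rot_mult rep_mult)
  show "x \<otimes>\<^bsub>C\<^esub> y \<in> extension \<psi>"
    using D rot norm_mult[OF D(1,5,4,8)] character_mult[OF assms(1) D(2,6)]
    by (intro extensionI[where g = "r' x \<otimes>\<^bsub>G\<^esub> r' y"]) (auto simp: versor_mult)
  show "r' (x \<otimes>\<^bsub>C\<^esub> y) = r' x \<otimes>\<^bsub>G\<^esub> r' y" using D rot by (intro rot_to_eqI) auto
qed

lemma extension_sc:
  assumes "character \<psi>"
  shows "sc c \<in> extension \<psi> \<longleftrightarrow> c\<^sup>2 = 1" "c\<^sup>2 = 1 \<Longrightarrow> r' (sc c) = \<one>\<^bsub>G\<^esub>"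
proof -
  have r: "r' (sc c) = \<one>\<^bsub>G\<^esub>" if "c \<noteq> 0"
    using that by (intro rot_to_eqI) (simp_all add: rep_one rot_sc)
  show "c\<^sup>2 = 1 \<Longrightarrow> r' (sc c) = \<one>\<^bsub>G\<^esub>" using r by fastforce
  show "sc c \<in> extension \<psi> \<longleftrightarrow> c\<^sup>2 = 1"
  proof
    assume "c\<^sup>2 = 1"
    then have "c \<noteq> 0" by auto
    with \<open>c\<^sup>2 = 1\<close> show "sc c \<in> extension \<psi>"
      by (intro extensionI[where g = "\<one>\<^bsub>G\<^esub>"])
        (simp_all add: versors.scalar rot_sc rep_one norm_sc character_one[OF assms])
  next
    assume e: "sc c \<in> extension \<psi>"
    have "c \<noteq> 0"
    proof
      assume "c = 0"
      then have "sc c \<in> part True" "sc c \<in> part False"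
        by (auto simp: part_def tensor_part_zero sc_eq tensor_scalar_hom)
      with part_unique[OF versor_Units[OF extensionD(1)[OF e]]] show False by blast
    qed
    with extensionD(4)[OF e] r show "c\<^sup>2 = 1"
      by (auto simp: norm_sc character_one[OF assms] dest: sc_inj)
  qed
qed

text \<open>For inverses, both the matrix and the norm are obtained by cancellation, since
  \<open>cl_rot\<close> and the norm are multiplicative on versors.\<close>

lemma extension_subgroup:
  assumes chi: "character \<psi>"
  shows "subgroup (extension \<psi>) CG"
proof (rule CG.subgroupI)
  show "extension \<psi> \<subseteq> carrier CG" by (auto dest: extensionD)
  show "extension \<psi> \<noteq> {}" using extension_sc(1)[OF chi, of 1] by auto
  show "x \<otimes>\<^bsub>CG\<^esub> y \<in> extension \<psi>" if "x \<in> extension \<psi>" "y \<in> extension \<psi>" for x y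
    using extension_mult(1)[OF chi that] by simp
  fix x assume x: "x \<in> extension \<psi>"
  note D = extensionD[OF x]
  let ?y = "inv\<^bsub>CG\<^esub> x" and ?g = "inv\<^bsub>G\<^esub> r' x"
  have y: "?y \<in> versors" "?y \<otimes>\<^bsub>C\<^esub> x = \<one>\<^bsub>C\<^esub>" "x \<otimes>\<^bsub>C\<^esub> ?y = \<one>\<^bsub>C\<^esub>"
    using CG.inv_closed[of x] CG.l_inv[of x] CG.r_inv[of x] D by simp_all
  have xy: "cl_rot q x ** cl_rot q ?y = mat 1"
    using rot_mult[OF D(1) y(1)] y rot_sc[of 1] by (simp add: sc_one)
  have "\<rho> ?g ** cl_rot q x = mat 1"
    using rep_mult[of ?g "r' x"] D(2) rep_one by (simp add: D(3))
  then have "cl_rot q ?y = \<rho> ?g ** (cl_rot q x ** cl_rot q ?y)" by (simp add: matrix_mul_assoc)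
  then have rot: "cl_rot q ?y = \<rho> ?g" by (simp add: xy)
  obtain d where d: "cl_norm q ?y = sc d" using norm_versor[OF y(1)] by blast
  have "sc (d * \<psi> (r' x)) = sc 1"
    using norm_mult[OF y(1) D(1) d D(4)] norm_sc[of 1] by (simp add: y sc_one)
  moreover have "\<psi> ?g * \<psi> (r' x) = 1"
    using character_mult[OF chi, of ?g "r' x"] D character_one[OF chi] by simp
  ultimately have "d = \<psi> ?g"
    using sc_inj character_nonzero[OF chi D(2)] by (metis mult_right_cancel)
  then show "?y \<in> extension \<psi>" using y D rot d by (intro extensionI[where g = ?g]) auto
qed

lemma of_int_mu2_inj: "\<epsilon> \<in> carrier mu2 \<Longrightarrow> \<delta> \<in> carrier mu2 \<Longrightarrow> (of_int \<epsilon> :: 'a) = of_int \<delta> \<Longrightarrow> \<epsilon> = \<delta>"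
proof -
  have "(1::'a) \<noteq> - 1" using two by (metis add.right_inverse one_add_one)
  then show "\<epsilon> \<in> carrier mu2 \<Longrightarrow> \<delta> \<in> carrier mu2 \<Longrightarrow> (of_int \<epsilon> :: 'a) = of_int \<delta> \<Longrightarrow> \<epsilon> = \<delta>"
    by (auto simp: mu2_def)
qed

lemma group_mu2: "group mu2"
  by (rule groupI) (auto simp: mu2_def)

lemma extension_exact:
  assumes chi: "character \<psi>"
  shows "short_exact mu2 (CG\<lparr>carrier := extension \<psi>\<rparr>) G j r'"
  unfolding short_exact_def
proof (intro conjI)
  have mu2: "\<epsilon> = 1 \<or> \<epsilon> = - 1" if "\<epsilon> \<in> carrier mu2" for \<epsilon> using that by (auto simp: mu2_def)
  show "group mu2" by (rule group_mu2)
  show "group (CG\<lparr>carrier := extension \<psi>\<rparr>)"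
    by (rule CG.subgroup_imp_group[OF extension_subgroup[OF chi]])
  show "group G" by (rule G.is_group)
  have "j \<epsilon> \<in> extension \<psi>" if "\<epsilon> \<in> carrier mu2" for \<epsilon>
    using mu2[OF that] extension_sc(1)[OF chi, of "of_int \<epsilon>"] by auto
  moreover have "j (\<epsilon> \<otimes>\<^bsub>mu2\<^esub> \<delta>) = j \<epsilon> \<otimes>\<^bsub>C\<^esub> j \<delta>" for \<epsilon> \<delta>
    by (simp add: mu2_def sc_mult)
  moreover have "inj_on j (carrier mu2)"
    by (intro inj_onI) (blast intro: of_int_mu2_inj sc_inj)
  ultimately show "j \<in> mon mu2 (CG\<lparr>carrier := extension \<psi>\<rparr>)"
    by (auto simp: mon_def hom_def)
  have "r' ` extension \<psi> = carrier G"
  proof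
    show "r' ` extension \<psi> \<subseteq> carrier G" using extensionD by blast
    show "carrier G \<subseteq> r' ` extension \<psi>" using extension_lift[OF _ chi] by blast
  qed
  then show "r' \<in> epi (CG\<lparr>carrier := extension \<psi>\<rparr>) G"
    by (auto simp: epi_def hom_def extension_mult[OF chi] dest: extensionD)
  show "kernel (CG\<lparr>carrier := extension \<psi>\<rparr>) G r' = j ` carrier mu2"
  proof
    show "j ` carrier mu2 \<subseteq> kernel (CG\<lparr>carrier := extension \<psi>\<rparr>) G r'"
      using mu2 extension_sc[OF chi] by (fastforce simp: kernel_def)
    show "kernel (CG\<lparr>carrier := extension \<psi>\<rparr>) G r' \<subseteq> j ` carrier mu2"
    proof
      fix x assume "x \<in> kernel (CG\<lparr>carrier := extension \<psi>\<rparr>) G r'"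
      then have x: "x \<in> extension \<psi>" "r' x = \<one>\<^bsub>G\<^esub>" by (auto simp: kernel_def)
      then obtain c where c: "x = sc c"
        using rot_eq_one_imp_scalar[OF extensionD(1)] extensionD(3)[of x \<psi>] rep_one by auto
      then have "c\<^sup>2 = 1" using extension_sc(1)[OF chi] x by blast
      then have "c = of_int 1 \<or> c = of_int (- 1)" by (simp add: power2_eq_1_iff)
      then show "x \<in> j ` carrier mu2" unfolding c mu2_def by auto
    qed
  qed
qed

section \<open>Comparing two extensions inside the Clifford group\<close>

lemma signed_word_subgroup:
  assumes E: "subgroup E CG" and "sc (- 1) \<in> E" "\<And>i. i \<in> {2..\<kappa>} \<Longrightarrow> s i \<in> E"
  shows "signed_word (CG\<lparr>carrier := E\<rparr>) j \<kappa> s l e = signed_word CG j \<kappa> s l e"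
proof -
  have m: "map (\<lambda>i. s i [^]\<^bsub>CG\<lparr>carrier := E\<rparr>\<^esub> e i) [2..<Suc \<kappa>] = map (\<lambda>i. s i [^]\<^bsub>CG\<^esub> e i) [2..<Suc \<kappa>]"
    by (rule map_cong) (auto simp: assms simp flip: CG.int_pow_consistent[OF E])
  show ?thesis
    unfolding signed_word_def ordered_prod_def m
    using assms(2) by (simp del: upt_Suc flip: CG.int_pow_consistent[OF E])
qed

lemma commutator_subgroup:
  assumes "subgroup E CG" "x \<in> E" "y \<in> E"
  shows "commutator (CG\<lparr>carrier := E\<rparr>) x y = commutator CG x y"
  using CG.m_inv_consistent[OF assms(1)] assms(2,3) by (simp add: commutator_def)

text \<open>Both extensions live in one Clifford group and share the lifts of all generators but the
  first. Signed words omit the first generator, so they are the same elements on both sides, and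
  every required equivalence relates two identical equations. The lemma is symmetric in the two
  characters, so that it serves both alternatives of the theorem.\<close>

lemma is_twist_of_lifts:
  assumes psi: "character \<psi>" "character \<psi>'" and \<kappa>: "\<kappa> \<ge> 1"
    and s: "\<And>i. i \<in> {1..\<kappa>} \<Longrightarrow> s i \<in> extension \<psi> \<and> r' (s i) = \<sigma> i"
    and t: "\<And>i. i \<in> {1..\<kappa>} \<Longrightarrow> t i \<in> extension \<psi>' \<and> r' (t i) = \<sigma> i"
    and ord: "G.ord (\<sigma> 1) = 2 ^ (n - 1)"
    and s1: "s 1 [^]\<^bsub>CG\<^esub> (2 ^ (n - 1) :: nat) = \<one>\<^bsub>C\<^esub>"
    and t1: "t 1 [^]\<^bsub>CG\<^esub> (2 ^ (n - 1) :: nat) = sc (- 1)"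
    and eq: "\<And>i. i \<in> {2..\<kappa>} \<Longrightarrow> s i = t i"
    and comm: "\<And>i k. i \<in> {1..\<kappa>} \<Longrightarrow> k \<in> {1..\<kappa>} \<Longrightarrow>
      commutator CG (s i) (s k) = commutator CG (t i) (t k)"
  shows "is_twist G \<sigma> \<kappa> n (CG\<lparr>carrier := extension \<psi>\<rparr>) j r' (CG\<lparr>carrier := extension \<psi>'\<rparr>) j r'"
proof -
  note E = extension_subgroup[OF psi(1)] and E' = extension_subgroup[OF psi(2)]
  have minus: "sc (- 1) \<in> extension \<psi>" "sc (- 1) \<in> extension \<psi>'"
    using extension_sc(1) psi by simp_all
  have word: "signed_word (CG\<lparr>carrier := extension \<psi>\<rparr>) j \<kappa> s l e =
      signed_word (CG\<lparr>carrier := extension \<psi>'\<rparr>) j \<kappa> t l e" for l e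
  proof -
    have "map (\<lambda>i. s i [^]\<^bsub>CG\<^esub> e i) [2..<Suc \<kappa>] = map (\<lambda>i. t i [^]\<^bsub>CG\<^esub> e i) [2..<Suc \<kappa>]"
      by (rule map_cong) (auto simp: eq)
    then have "signed_word CG j \<kappa> s l e = signed_word CG j \<kappa> t l e" by (simp only: signed_word_def)
    with s t minus show ?thesis
      by (subst (1 2) signed_word_subgroup) (auto simp: E E')
  qed
  have pow: "s i [^]\<^bsub>CG\<lparr>carrier := extension \<psi>\<rparr>\<^esub> a = t i [^]\<^bsub>CG\<lparr>carrier := extension \<psi>'\<rparr>\<^esub> a"
    if "i \<in> {2..\<kappa>}" for i and a :: int
    using CG.int_pow_consistent[OF E, of "s i" a] CG.int_pow_consistent[OF E', of "t i" a]
      s[of i] t[of i] eq[OF that] that by simp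
  have comm': "commutator (CG\<lparr>carrier := extension \<psi>\<rparr>) (s i) (s k) =
      commutator (CG\<lparr>carrier := extension \<psi>'\<rparr>) (t i) (t k)"
    if "i \<in> {1..\<kappa>}" "k \<in> {1..\<kappa>}" for i k
    using comm[OF that] s t that by (simp add: commutator_subgroup E E')
  interpret E: group "CG\<lparr>carrier := extension \<psi>\<rparr>" by (rule CG.subgroup_imp_group[OF E])
  interpret r: group_hom "CG\<lparr>carrier := extension \<psi>\<rparr>" G r'
    using extension_exact[OF psi(1)]
    by (intro group_hom.intro group_hom_axioms.intro) (auto simp: short_exact_def epi_def)
  have s1E: "s 1 \<in> extension \<psi>" "r' (s 1) = \<sigma> 1" using s[of 1] \<kappa> by auto
  \<comment> \<open>The hypothesis on the power of \<open>s 1\<close> bounds the order from above;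
    mapping down to \<open>\<sigma> 1\<close> bounds it from below.\<close>
  have "E.ord (s 1) = 2 ^ (n - 1)"
  proof (rule dvd_antisym)
    show "E.ord (s 1) dvd 2 ^ (n - 1)"
      using s1E s1 by (subst E.pow_eq_id[symmetric]) (simp_all flip: CG.nat_pow_consistent)
    have "r' (s 1 [^]\<^bsub>CG\<lparr>carrier := extension \<psi>\<rparr>\<^esub> E.ord (s 1)) = \<sigma> 1 [^]\<^bsub>G\<^esub> E.ord (s 1)"
      using r.hom_nat_pow[of "s 1" "E.ord (s 1)"] s1E by (simp del: E.pow_ord_eq_1)
    moreover have "s 1 [^]\<^bsub>CG\<lparr>carrier := extension \<psi>\<rparr>\<^esub> E.ord (s 1) = \<one>\<^bsub>CG\<lparr>carrier := extension \<psi>\<rparr>\<^esub>"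
      using s1E by (intro E.pow_ord_eq_1) simp
    ultimately have "\<sigma> 1 [^]\<^bsub>G\<^esub> E.ord (s 1) = \<one>\<^bsub>G\<^esub>" using r.hom_one by simp
    moreover have "\<sigma> 1 \<in> carrier G" using s1E extensionD(2) by metis
    ultimately show "2 ^ (n - 1) dvd E.ord (s 1)" using G.pow_eq_id ord by simp
  qed
  moreover have "t 1 [^]\<^bsub>CG\<lparr>carrier := extension \<psi>'\<rparr>\<^esub> (2 ^ (n - 1) :: nat) \<in> j ` carrier mu2"
    using t1 by (force simp: mu2_def simp flip: CG.nat_pow_consistent)
  moreover have "t 1 [^]\<^bsub>CG\<lparr>carrier := extension \<psi>'\<rparr>\<^esub> (2 ^ (n - 1) :: nat) \<noteq> \<one>\<^bsub>CG\<lparr>carrier := extension \<psi>'\<rparr>\<^esub>"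
  proof -
    have "(- 1 :: 'a) \<noteq> 1" using two by (metis add.left_inverse one_add_one)
    then show ?thesis
      using t1 sc_inj[of "- 1" 1] by (auto simp: sc_one simp flip: CG.nat_pow_consistent)
  qed
  ultimately show ?thesis
    unfolding is_twist_def using extension_exact psi s t pow comm' word
    by (intro conjI exI[of _ s] exI[of _ t]) auto
qed

lemma versor_sc_pow:
  assumes "c \<noteq> 0" "x \<in> versors"
  shows "(sc c \<otimes>\<^bsub>C\<^esub> x) [^]\<^bsub>CG\<^esub> (m::nat) = sc (c ^ m) \<otimes>\<^bsub>C\<^esub> (x [^]\<^bsub>CG\<^esub> m)"
proof -
  have "sc c [^]\<^bsub>CG\<^esub> m = sc (c ^ m)"
    by (induction m) (simp_all add: sc_one sc_mult sc_commute[OF sc_closed] power_commutes flip: sc_mult)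
  moreover have "sc c \<otimes>\<^bsub>CG\<^esub> x = x \<otimes>\<^bsub>CG\<^esub> sc c"
    using assms versor_closed sc_commute by simp
  ultimately show ?thesis
    using CG.pow_mult_distrib[of "sc c" x m] assms by (simp add: versors.scalar)
qed

lemma commutator_sc:
  assumes "a \<noteq> 0" "b \<noteq> 0" "x \<in> versors" "y \<in> versors"
  shows "commutator CG (sc a \<otimes>\<^bsub>C\<^esub> x) (sc b \<otimes>\<^bsub>C\<^esub> y) = commutator CG x y"
proof -
  have inv: "inv\<^bsub>CG\<^esub> (sc c \<otimes>\<^bsub>C\<^esub> z) = sc (1 / c) \<otimes>\<^bsub>C\<^esub> inv\<^bsub>CG\<^esub> z" if "c \<noteq> 0" "z \<in> versors" for c z
  proof (rule CG.inv_equality)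
    have z: "inv\<^bsub>CG\<^esub> z \<in> versors" "inv\<^bsub>CG\<^esub> z \<otimes>\<^bsub>C\<^esub> z = \<one>\<^bsub>C\<^esub>"
      using CG.inv_closed[of z] CG.l_inv[of z] that by simp_all
    note [simp] = versor_closed[OF z(1)] versor_closed[OF that(2)]
    have "sc (1 / c) \<otimes>\<^bsub>C\<^esub> inv\<^bsub>CG\<^esub> z \<otimes>\<^bsub>C\<^esub> (sc c \<otimes>\<^bsub>C\<^esub> z) = sc (1 / c * c) \<otimes>\<^bsub>C\<^esub> (inv\<^bsub>CG\<^esub> z \<otimes>\<^bsub>C\<^esub> z)"
      unfolding sc_mult by (simp add: C.m_assoc sc_left_commute[OF versor_closed[OF z(1)]])
    then show "sc (1 / c) \<otimes>\<^bsub>C\<^esub> inv\<^bsub>CG\<^esub> z \<otimes>\<^bsub>CG\<^esub> (sc c \<otimes>\<^bsub>C\<^esub> z) = \<one>\<^bsub>CG\<^esub>"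
      using that by (simp add: z(2) sc_one)
    show "sc (1 / c) \<otimes>\<^bsub>C\<^esub> inv\<^bsub>CG\<^esub> z \<in> carrier CG"
      using versor_smult[OF z(1)] that by simp
  qed (use that in \<open>simp add: versor_smult\<close>)
  have i: "inv\<^bsub>CG\<^esub> x \<in> versors" "inv\<^bsub>CG\<^esub> y \<in> versors"
    using CG.inv_closed assms by simp_all
  note cl = versor_closed[OF i(1)] versor_closed[OF i(2)] versor_closed[OF assms(3)] versor_closed[OF assms(4)]
  have "commutator CG (sc a \<otimes>\<^bsub>C\<^esub> x) (sc b \<otimes>\<^bsub>C\<^esub> y) =
      sc (1 / a * (1 / b) * a * b) \<otimes>\<^bsub>C\<^esub> (inv\<^bsub>CG\<^esub> x \<otimes>\<^bsub>C\<^esub> (inv\<^bsub>CG\<^esub> y \<otimes>\<^bsub>C\<^esub> (x \<otimes>\<^bsub>C\<^esub> y)))"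
    unfolding commutator_def inv[OF assms(1,3)] inv[OF assms(2,4)] clifford_group_simps sc_mult
    by (simp add: C.m_assoc cl sc_left_commute[OF cl(1)] sc_left_commute[OF cl(2)] sc_left_commute[OF cl(3)])
  then show ?thesis
    using assms cl by (simp add: commutator_def sc_one C.m_assoc)
qed

end

section \<open>Change of base field\<close>

lemma map_matrix_mult:
  fixes A :: "'a::semiring_1 ^ 'm::finite ^ 'l::finite"
  assumes "\<And>a b. h (a + b) = h a + h b" "\<And>a b. h (a * b) = h a * h b" "h 0 = 0"
  shows "map_matrix h (A ** M) = map_matrix h A ** map_matrix h M"
proof -
  have "h (sum f S) = (\<Sum>i\<in>S. h (f i))" for f and S :: "'m set"
    by (induction S rule: infinite_finite_induct) (simp_all add: assms)
  then show ?thesis by (simp add: vec_eq_iff matrix_matrix_mult_def assms)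
qed

lemma map_matrix_one: "h 0 = 0 \<Longrightarrow> h 1 = 1 \<Longrightarrow> map_matrix h (mat 1) = mat 1"
  by (simp add: vec_eq_iff mat_def)

lemma map_matrix_transpose: "map_matrix h (transpose A) = transpose (map_matrix h A)"
  by (simp add: vec_eq_iff transpose_def)

section \<open>Quadratic forms through their Gram matrices\<close>

lemma qform_eq: "qform P v = (\<Sum>i\<in>UNIV. v $ i * (P *v v) $ i)"
  by (simp add: qform_def matrix_vector_mult_def sum_distrib_left algebra_simps)

lemma sum_matrix_vector_mult_transpose:
  fixes A :: "'a::field ^ 'n::finite ^ 'm::finite"
  shows "(\<Sum>i\<in>UNIV. (A *v v) $ i * w $ i) = (\<Sum>k\<in>UNIV. v $ k * (transpose A *v w) $ k)"
proof -
  have "(\<Sum>i\<in>UNIV. (A *v v) $ i * w $ i) = (\<Sum>i\<in>UNIV. \<Sum>k\<in>UNIV. A $ i $ k * v $ k * w $ i)"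
    by (simp add: matrix_vector_mult_def sum_distrib_right)
  also have "\<dots> = (\<Sum>k\<in>UNIV. \<Sum>i\<in>UNIV. A $ i $ k * v $ k * w $ i)"
    by (rule sum.swap)
  finally show ?thesis
    by (simp add: matrix_vector_mult_def transpose_def sum_distrib_left algebra_simps)
qed

lemma qform_substitute: "qform P (A *v v) = qform (transpose A ** P ** A) v"
  by (simp add: qform_eq sum_matrix_vector_mult_transpose matrix_vector_mul_assoc matrix_mul_assoc)

lemma polar_qform_axis: "polar (qform P) v (axis i 1) = ((P + transpose P) *v v) $ i"
proof -
  have "polar (qform P) v (axis i 1) =
      (\<Sum>k\<in>UNIV. \<Sum>l\<in>UNIV. (P $ k $ l + P $ l $ k) * (v $ k * axis i 1 $ l))"
    by (rule polar_qform)
  also have "\<dots> = (\<Sum>k\<in>UNIV. \<Sum>l\<in>UNIV. if l = i then (P $ k $ i + P $ i $ k) * v $ k else 0)"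
    by (intro sum.cong) (auto simp: axis_def)
  finally show ?thesis
    by (simp add: matrix_vector_mult_def transpose_def algebra_simps)
qed

lemma polar_qform_polarized:
  "polar (qform P) v w = (\<Sum>i\<in>UNIV. ((P + transpose P) *v v) $ i * w $ i)"
proof -
  have "polar (qform P) v w = (\<Sum>i\<in>UNIV. \<Sum>k\<in>UNIV. (P $ k $ i + P $ i $ k) * (v $ k * w $ i))"
    unfolding polar_qform by (rule sum.swap)
  then show ?thesis
    by (simp add: matrix_vector_mult_def transpose_def sum_distrib_left sum_distrib_right algebra_simps)
qed

text \<open>Pairing with standard basis vectors recovers the Gram matrix from the values of the
  form, and dividing by 2 recovers the form from the Gram matrix.\<close>

lemma qform_eq_iff:
  fixes P P' :: "'a::field ^ 'n::finite ^ 'n"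
  assumes "(2::'a) \<noteq> 0"
  shows "qform P = qform P' \<longleftrightarrow> P + transpose P = P' + transpose P'"
proof
  assume eq: "qform P = qform P'"
  have "(P + transpose P) *v v = (P' + transpose P') *v v" for v
    using polar_qform_axis[of P v] polar_qform_axis[of P' v] by (simp add: vec_eq_iff eq)
  then show "P + transpose P = P' + transpose P'" by (simp add: matrix_eq)
next
  assume eq: "P + transpose P = P' + transpose P'"
  have "2 * qform P v = 2 * qform P' v" for v
    by (simp flip: polar_qform_self add: polar_qform_polarized eq)
  with assms show "qform P = qform P'" by auto
qed

text \<open>A left inverse of the Gram matrix can be mapped entrywise to a larger field, whereas a
  statement about all vectors cannot.\<close>

lemma regular_qform_iff:
  "regular_form (qform P) \<longleftrightarrow> (\<exists>M. M ** (P + transpose P) = mat 1)"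
proof -
  have "(\<forall>w. polar (qform P) v w = 0) \<longleftrightarrow> (P + transpose P) *v v = 0" for v
  proof
    assume "\<forall>w. polar (qform P) v w = 0"
    then show "(P + transpose P) *v v = 0"
      using polar_qform_axis[of P v] by (simp add: vec_eq_iff)
  qed (simp add: polar_qform_polarized)
  then show ?thesis
    unfolding regular_form_def matrix_left_invertible_ker by simp
qed

locale field_embedding =
  fixes h :: "'k::field \<Rightarrow> 'K::field"
  assumes h_one: "h 1 = 1" and h_add: "h (a + b) = h a + h b" and h_mult: "h (a * b) = h a * h b"
begin

lemma h_zero: "h 0 = 0"
  by (metis add_0 add_cancel_right_right h_add)

lemma h_nonzero: "a \<noteq> 0 \<Longrightarrow> h a \<noteq> 0"
  using h_mult[of a "inverse a"] h_one by auto

lemma h_inj: "h a = h b \<Longrightarrow> a = b"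
  using h_add[of "a - b" b] h_nonzero[of "a - b"] by auto

lemmas map_matrix_h = map_matrix_mult[of h, OF h_add h_mult h_zero] map_matrix_one[of h, OF h_zero h_one]
  map_matrix_transpose

lemma map_matrix_h_add: "map_matrix h (A + M) = map_matrix h A + map_matrix h M"
  by (simp add: vec_eq_iff h_add)

lemma map_matrix_h_inj: "map_matrix h A = map_matrix h M \<Longrightarrow> A = M"
  by (auto simp: vec_eq_iff intro: h_inj)

lemma regular_form_map:
  assumes "regular_form (qform P)"
  shows "regular_form (qform (map_matrix h P))"
proof -
  obtain M where "M ** (P + transpose P) = mat 1" using assms regular_qform_iff by blast
  then have "map_matrix h M ** (map_matrix h P + transpose (map_matrix h P)) = mat 1"
    by (simp flip: map_matrix_h map_matrix_h_add)
  then show ?thesis using regular_qform_iff by blast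
qed

text \<open>Invariance over the small field amounts to equality of the Gram matrices of
  \<open>P\<close> and of \<open>transpose A ** P ** A\<close>. That equality is mapped by
  \<open>h\<close> and read back as invariance over the large field.\<close>

lemma isometry_map:
  fixes A P :: "'k ^ 'n::finite ^ 'n"
  assumes "(2::'k) \<noteq> 0" "\<And>v. qform P (A *v v) = qform P v"
  shows "qform (map_matrix h P) (map_matrix h A *v v) = qform (map_matrix h P) v"
proof -
  have two: "(2::'K) \<noteq> 0" using h_nonzero[OF assms(1)] h_add[of 1 1] by (simp add: h_one)
  let ?P' = "transpose A ** P ** A"
  have "qform ?P' = qform P" using assms(2) by (auto simp: qform_substitute)
  then have "?P' + transpose ?P' = P + transpose P" using qform_eq_iff assms(1) by blast
  then have "map_matrix h ?P' + transpose (map_matrix h ?P') = map_matrix h P + transpose (map_matrix h P)"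
    by (metis map_matrix_h(3) map_matrix_h_add)
  then have "qform (map_matrix h ?P') = qform (map_matrix h P)" using qform_eq_iff two by blast
  then show ?thesis by (simp add: qform_substitute map_matrix_h)
qed

lemma representation_map:
  fixes P :: "'k ^ 'n::finite ^ 'n"
  assumes "(2::'k) \<noteq> 0" "\<rho> \<in> mon G (orthogonal_grp (qform P))"
  shows "(\<lambda>g. map_matrix h (\<rho> g)) \<in> mon G (orthogonal_grp (qform (map_matrix h P)))"
proof -
  have "invertible (map_matrix h A)" if "invertible A" for A :: "'k ^ 'n ^ 'n"
    using that unfolding invertible_def by (metis map_matrix_h(1,2))
  moreover have "qform (map_matrix h P) (map_matrix h A *v v) = qform (map_matrix h P) v"
    if "\<forall>v. qform P (A *v v) = qform P v" for A :: "'k ^ 'n ^ 'n" and v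
    using isometry_map[OF assms(1)] that by blast
  ultimately show ?thesis
    using assms(2)
    by (auto simp: mon_def hom_def orthogonal_grp_def inj_on_def map_matrix_h Pi_iff dest!: map_matrix_h_inj)
qed

end

text \<open>For nonzero \<open>c\<close> the polynomial \<open>X^2 - c\<close> is separable:
  subtracting \<open>X / 2\<close> times its derivative leaves the unit \<open>- c\<close>.\<close>

lemma separable_closure_sqrt:
  fixes h :: "'k::field \<Rightarrow> 'K::field"
  assumes "separable_closure h" and two: "(2::'K) \<noteq> 0"
  shows "\<exists>y. y\<^sup>2 = (c::'K)"
proof (cases "c = 0")
  case False
  let ?p = "[:- c, 0, 1:]"
  have pd: "Polynomial.pderiv ?p = [:0, 2:]"
    by (simp add: pderiv_pCons)
  have "Rings.coprime ?p (Polynomial.pderiv ?p)"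
  proof (rule coprimeI)
    fix d assume d: "d dvd ?p" "d dvd Polynomial.pderiv ?p"
    have "?p - [:0, 1 / 2:] * Polynomial.pderiv ?p = [:- c:]"
      using two by (simp add: pd)
    then have "d dvd [:- c:]" using d by (metis dvd_diff dvd_mult)
    moreover have "[:- c:] dvd 1" using False by (simp add: is_unit_pCons_iff)
    ultimately show "is_unit d" by (rule dvd_trans)
  qed
  moreover have "Polynomial.degree ?p > 0" by simp
  ultimately obtain y where "Polynomial.poly ?p y = 0"
    using assms(1) unfolding separable_closure_def by blast
  then have "y\<^sup>2 = c" by (simp add: power2_eq_square)
  then show ?thesis by blast
qed auto

text \<open>\<open>field_units\<close> refers to \<open>Ring_Divisibility.mult_of\<close>, not to the constant of the same name in
  \<open>Multiplicative_Group\<close>.\<close>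

lemma field_units_simps [simp]:
  "carrier (field_units :: 'a::field monoid) = - {0}"
  "x \<otimes>\<^bsub>field_units\<^esub> y = x * y" "\<one>\<^bsub>field_units\<^esub> = (1::'a)"
  by (auto simp: Ring_Divisibility.mult_of_def)

lemma group_field_units: "group (field_units :: 'a::field monoid)"
proof (rule groupI)
  show "\<exists>y\<in>carrier field_units. y \<otimes>\<^bsub>field_units\<^esub> x = \<one>\<^bsub>field_units\<^esub>"
    if "x \<in> carrier field_units" for x :: 'a
    using that by (intro bexI[of _ "inverse x"]) auto
qed auto

lemma short_exact_field_units:
  "short_exact (singleton_group (1::int)) field_units (field_units :: 'a::field monoid) (\<lambda>_. 1) id"
  unfolding short_exact_def using group_field_units
  by (auto simp: mon_def epi_def hom_def kernel_def)

theorem proposition5p1: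
  fixes h :: "'k::field \<Rightarrow> 'K::field"
    and n \<kappa> :: nat
    and G :: "'g monoid" and \<sigma> :: "nat \<Rightarrow> 'g" and H :: "'g set"
    and \<zeta> :: 'K and \<phi> :: "'g set \<Rightarrow> 'K"
    and Q :: "'k ^ 'n::finite ^ 'n" and \<rho> :: "'g \<Rightarrow> 'k ^ 'n ^ 'n"
    and q :: "'k ^ 'n \<Rightarrow> 'k" and qbar :: "'K ^ 'n \<Rightarrow> 'K" and \<rho>bar :: "'g \<Rightarrow> 'K ^ 'n ^ 'n"
    and Gtilde :: "('K, 'n) cliff set"
  assumes char: "CHAR('k) \<noteq> 2"
    and closure: "separable_closure h"
    and n: "n > 1"
    and G: "group G" "finite (carrier G)"
    and gens: "\<kappa> \<ge> 1" "\<sigma> ` {1..\<kappa>} \<subseteq> carrier G" "generate G (\<sigma> ` {1..\<kappa>}) = carrier G"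
    and ord: "group.ord G (\<sigma> 1) = 2 ^ (n - 1)"
    and H: "H = generate G (\<sigma> ` {2..\<kappa>})" "H \<lhd> G"
    and cyclic: "(G Mod H) \<cong> integer_mod_group (2 ^ (n - 1))"
      "\<And>i::nat. 1 \<le> i \<Longrightarrow> i < 2 ^ (n - 1) \<Longrightarrow> \<sigma> 1 [^]\<^bsub>G\<^esub> i \<notin> H"
    and zeta: "primitive_root_of_unity (2 ^ (n - 1)) \<zeta>"
    and phi: "\<phi> \<in> Group.iso (G Mod H) (field_units\<lparr>carrier := generate field_units {\<zeta>}\<rparr>)"
      "\<phi> (H #>\<^bsub>G\<^esub> \<sigma> 1) = \<zeta>"
    and q: "q = qform Q" "regular_form q"
    and rep: "\<rho> \<in> mon G (orthogonal_grp q)"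
    and qbar: "qbar = qform (map_matrix h Q)"
    and rhobar: "\<rho>bar = (\<lambda>g. map_matrix h (\<rho> g))"
    and Gtilde: "Gtilde = pin_preimage qbar G \<rho>bar"
  shows "\<exists>Gbar.
    subgroup Gbar (clifford_group qbar) \<and>
    (let Gb = (clifford_group qbar)\<lparr>carrier := Gbar\<rparr>;
         Gt = (clifford_group qbar)\<lparr>carrier := Gtilde\<rparr>;
         j = (\<lambda>\<epsilon>. cl_scalar qbar (of_int \<epsilon>));
         r' = rot_to qbar G \<rho>bar
     in
       \<comment> \<open>(1): \<open>r\<close> restricts to a map \<open>r'\<close> to \<open>G\<close>, the rows are exact, the squares commute\<close>
       (\<forall>x\<in>Gbar. cl_rot qbar x \<in> \<rho>bar ` carrier G) \<and>
       short_exact mu2 Gb G j r' \<and>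
       short_exact (singleton_group (1::int)) field_units (field_units :: 'K monoid) (\<lambda>_. 1) id \<and>
       (\<forall>\<epsilon>\<in>carrier mu2. cl_norm qbar (j \<epsilon>) = cl_scalar qbar 1) \<and>
       (\<forall>x\<in>Gbar. cl_norm qbar x = cl_scalar qbar (\<phi> (H #>\<^bsub>G\<^esub> r' x))) \<and>
       \<comment> \<open>(2)\<close>
       (is_twist G \<sigma> \<kappa> n Gt j r' Gb j r' \<or> is_twist G \<sigma> \<kappa> n Gb j r' Gt j r'))"
proof -
  have two_k: "(2::'k) \<noteq> 0"
  proof
    assume "(2::'k) = 0"
    then have "CHAR('k) dvd 2" using of_nat_eq_0_iff_char_dvd[of 2, where ?'a = 'k] by simp
    then have "CHAR('k) = 1 \<or> CHAR('k) = 2" using prime_nat_iff two_is_prime_nat by blast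
    with char show False by simp
  qed
  interpret h: field_embedding h
    using closure by unfold_locales (auto simp: separable_closure_def)
  have two: "(2::'K) \<noteq> 0"
    using h.h_nonzero[OF two_k] h.h_add[of 1 1] by (simp add: h.h_one)
  interpret G: group G by (rule G(1))
  interpret H: normal H G by (rule H(2))
  \<comment> \<open>The Gram matrix arguments supply the regular form and the faithful
    representation over the closure.\<close>
  interpret orthogonal_representation "map_matrix h Q" qbar G \<rho>bar
  proof unfold_locales
    show "regular_form qbar" using h.regular_form_map q qbar by simp
    show "\<rho>bar \<in> mon G (orthogonal_grp qbar)"
      unfolding qbar rhobar using h.representation_map[OF two_k] rep q by simp
    show "\<exists>y. y\<^sup>2 = c" for c :: 'K by (rule separable_closure_sqrt[OF closure two])
  qed (simp_all add: qbar two)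
  define m :: nat where "m = 2 ^ (n - 1)"
  have "m > 1" unfolding m_def by (rule one_less_power) (use n in auto)
  \<comment> \<open>Evenness lets \<open>c ^ m\<close> be read as a power of
    \<open>\<zeta>\<close>.\<close>
  moreover have "even m" using n by (simp add: m_def)
  ultimately have m: "m > 1" "even m" by auto
  have zeta_m: "\<zeta> ^ m = 1" "\<And>i. 1 \<le> i \<Longrightarrow> i < m \<Longrightarrow> \<zeta> ^ i \<noteq> 1"
    using zeta by (auto simp: primitive_root_of_unity_def m_def)
  then have zeta0: "\<zeta> \<noteq> 0" using m by (auto simp: power_0_left)
  define \<psi> where "\<psi> = (\<lambda>g. \<phi> (H #>\<^bsub>G\<^esub> g))"
  have coset: "H #>\<^bsub>G\<^esub> g \<in> carrier (G Mod H)" if "g \<in> carrier G" for g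
    using that by (auto simp: FactGroup_def RCOSETS_def)
  have phi_hom: "\<phi> \<in> hom (G Mod H) (field_units\<lparr>carrier := generate field_units {\<zeta>}\<rparr>)"
    using phi(1) by (simp add: iso_def)
  have psi: "character \<psi>"
    unfolding character_def
  proof (intro conjI ballI)
    fix g assume g: "g \<in> carrier G"
    have "generate field_units {\<zeta>} \<subseteq> carrier (field_units :: 'K monoid)"
      by (rule group.generate_incl[OF group_field_units]) (simp add: zeta0)
    then show "\<psi> g \<noteq> 0" using hom_in_carrier[OF phi_hom coset[OF g]] by (auto simp: \<psi>_def)
    fix g' assume g': "g' \<in> carrier G"
    show "\<psi> (g \<otimes>\<^bsub>G\<^esub> g') = \<psi> g * \<psi> g'"
      using hom_mult[OF phi_hom coset[OF g] coset[OF g']] H.rcos_sum[OF g g']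
      by (simp add: \<psi>_def FactGroup_def)
  qed
  have one: "character (\<lambda>_. 1)" by (simp add: character_def)
  have psi_H: "\<psi> g = 1" if "g \<in> H" for g
    using H.rcos_const[OF G(1) that] H.rcos_const[OF G(1) H.one_closed] character_one[OF psi]
    by (simp add: \<psi>_def)
  have sigma: "\<sigma> i \<in> carrier G" if "i \<in> {1..\<kappa>}" for i using gens that by blast
  have "\<exists>x. x \<in> extension (\<lambda>_. 1) \<and> r' x = g" if "g \<in> carrier G" for g
    using extension_lift[OF that one] by blast
  then obtain L where L: "\<And>g. g \<in> carrier G \<Longrightarrow> L g \<in> extension (\<lambda>_. 1)" "\<And>g. g \<in> carrier G \<Longrightarrow> r' (L g) = g"
    by metis
  define s where "s = (\<lambda>i. L (\<sigma> i))"
  obtain c where c: "c\<^sup>2 = \<zeta>" using sqrt_exists by blast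
  have c0: "c \<noteq> 0" using c zeta0 by auto
  have cm: "c ^ m = - 1"
  proof -
    \<comment> \<open>The exponent lies strictly between 0 and \<open>m\<close>, so by primitivity
      this power is not 1; its square is 1, which leaves -1.\<close>
    have "\<zeta> ^ (m div 2) = c ^ m" using m(2) unfolding c[symmetric] by (simp flip: power_mult)
    then have "c ^ m \<noteq> 1" using zeta_m(2)[of "m div 2"] m by (auto elim: evenE)
    moreover have "(c ^ m)\<^sup>2 = 1" using zeta_m(1) c by (metis mult.commute power_mult)
    ultimately show ?thesis by (simp add: power2_eq_1_iff)
  qed
  \<comment> \<open>A square root of \<open>\<psi> (\<sigma> i)\<close> for each generator:
    \<open>\<psi>\<close> takes the value \<open>\<zeta>\<close> at \<open>\<sigma> 1\<close> and 1
    on \<open>H\<close>. Scaling \<open>s i\<close> by it gives the norm required in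
    \<open>extension \<psi>\<close>.\<close>
  define a where "a = (\<lambda>i::nat. if i = 1 then c else 1)"
  define t where "t = (\<lambda>i. sc (a i) \<otimes>\<^bsub>C\<^esub> s i)"
  have s: "s i \<in> extension (\<lambda>_. 1) \<and> r' (s i) = \<sigma> i" if "i \<in> {1..\<kappa>}" for i
    using L sigma[OF that] by (simp add: s_def)
  have s_versor: "s i \<in> versors" if "i \<in> {1..\<kappa>}" for i using s[OF that] extensionD by blast
  have a: "a i \<noteq> 0" "i \<in> {1..\<kappa>} \<Longrightarrow> (a i)\<^sup>2 = \<psi> (\<sigma> i)" for i
    using c c0 phi(2) psi_H[of "\<sigma> i"] generate.incl[of "\<sigma> i" "\<sigma> ` {2..\<kappa>}" G]
    by (auto simp: a_def \<psi>_def H(1))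
  have t: "t i \<in> extension \<psi> \<and> r' (t i) = \<sigma> i" if i: "i \<in> {1..\<kappa>}" for i
  proof -
    note D = extensionD[of "s i" "\<lambda>_. 1"] s[OF i]
    have rot: "cl_rot qbar (t i) = \<rho>bar (\<sigma> i)"
      using D a(1) by (simp add: t_def rot_mult versors.scalar rot_sc)
    moreover have "cl_norm qbar (t i) = sc (\<psi> (\<sigma> i))"
      unfolding t_def using norm_mult[OF versors.scalar[OF a(1)[of i]] _ norm_sc, of "s i" 1] D a(2)[OF i] by simp
    moreover have "t i \<in> versors"
      unfolding t_def using versor_smult a(1) s_versor[OF i] by blast
    ultimately show ?thesis using sigma[OF i] by (auto intro: extensionI rot_to_eqI)
  qed
  have t_eq: "s i = t i" if "i \<in> {2..\<kappa>}" for i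
    using that s_versor[of i] versor_closed by (simp add: t_def a_def sc_one)
  have comm: "commutator CG (s i) (s k) = commutator CG (t i) (t k)"
    if "i \<in> {1..\<kappa>}" "k \<in> {1..\<kappa>}" for i k
    unfolding t_def using commutator_sc a(1) s_versor that by simp
  have one_in: "1 \<in> {1..\<kappa>}" using gens(1) by simp
  have t1: "t 1 [^]\<^bsub>CG\<^esub> m = sc (- 1) \<otimes>\<^bsub>C\<^esub> (s 1 [^]\<^bsub>CG\<^esub> m)"
    unfolding t_def using versor_sc_pow[OF a(1) s_versor[OF one_in], of 1 m] by (simp add: a_def cm)
  \<comment> \<open>This power lies over the neutral element, so exactness makes it one of the two
    signs.\<close>
  have "s 1 [^]\<^bsub>CG\<^esub> m \<in> extension (\<lambda>_. 1) \<and> r' (s 1 [^]\<^bsub>CG\<^esub> m) = \<one>\<^bsub>G\<^esub>"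
  proof -
    have "s 1 [^]\<^bsub>CG\<^esub> k \<in> extension (\<lambda>_. 1) \<and> r' (s 1 [^]\<^bsub>CG\<^esub> k) = \<sigma> 1 [^]\<^bsub>G\<^esub> k" for k :: nat
    proof (induction k)
      case 0
      show ?case using extension_sc[OF one, of 1] by (simp add: sc_one)
    next
      case (Suc k)
      then show ?case using extension_mult[OF one] s[OF one_in] by simp
    qed
    moreover have "\<sigma> 1 [^]\<^bsub>G\<^esub> m = \<one>\<^bsub>G\<^esub>"
      using G.pow_ord_eq_1[OF sigma[OF one_in]] ord by (simp add: m_def)
    ultimately show ?thesis by simp
  qed
  then have "s 1 [^]\<^bsub>CG\<^esub> m \<in> j ` carrier mu2"
    using extension_exact[OF one] by (auto simp: short_exact_def kernel_def)
  then have "s 1 [^]\<^bsub>CG\<^esub> m = \<one>\<^bsub>C\<^esub> \<or> s 1 [^]\<^bsub>CG\<^esub> m = sc (- 1)"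
    by (auto simp: mu2_def sc_one)
  then have twist: "is_twist G \<sigma> \<kappa> n (CG\<lparr>carrier := extension (\<lambda>_. 1)\<rparr>) j r' (CG\<lparr>carrier := extension \<psi>\<rparr>) j r' \<or>
      is_twist G \<sigma> \<kappa> n (CG\<lparr>carrier := extension \<psi>\<rparr>) j r' (CG\<lparr>carrier := extension (\<lambda>_. 1)\<rparr>) j r'"
  proof
    assume s1: "s 1 [^]\<^bsub>CG\<^esub> m = \<one>\<^bsub>C\<^esub>"
    then have "t 1 [^]\<^bsub>CG\<^esub> m = sc (- 1)" using t1 by simp
    with s1 show ?thesis
      by (intro disjI1 is_twist_of_lifts[where s = s and t = t, OF one psi gens(1) s t ord _ _ t_eq comm]) (simp_all add: m_def)
  next
    \<comment> \<open>The factor \<open>c ^ m = - 1\<close> now makes \<open>t 1\<close> the lift of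
      order \<open>m\<close>, so the two extensions exchange roles.\<close>
    assume s1: "s 1 [^]\<^bsub>CG\<^esub> m = sc (- 1)"
    then have "t 1 [^]\<^bsub>CG\<^esub> m = \<one>\<^bsub>C\<^esub>" using t1 by (simp add: sc_one flip: sc_mult)
    with s1 show ?thesis
      by (intro disjI2 is_twist_of_lifts[where s = t and t = s, OF psi one gens(1) t s ord _ _ t_eq[symmetric] comm[symmetric]])
        (simp_all add: m_def)
  qed
  have "cl_norm qbar (j \<epsilon>) = sc 1" if "\<epsilon> \<in> carrier mu2" for \<epsilon>
    using that by (auto simp: mu2_def norm_sc)
  then show ?thesis
    unfolding Let_def Gtilde pin_preimage_eq
    using extension_subgroup[OF psi] extension_exact[OF psi] short_exact_field_units twist
    by (intro exI[of _ "extension \<psi>"]) (auto simp: \<psi>_def extension_def)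
qed

end
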